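(* Let $\mathcal{I}$ be an ideal and $G$ a $3$-$\mathcal{I}$-generic set. Then no $3$-$\langle G\rangle$-generic set contained in $G$ computes $G$, where $\langle G\rangle=\{X: X\le_T G\}$.
   Context: Sets are subsets of $\omega$. A (Turing) ideal is a (countable) collection of sets closed under $\le_T$ and $\oplus$. Each ideal $\mathcal{I}$ is presented by a fixed exact pair $A_0,A_1$ (so $S\in\mathcal{I}$ iff $S\le_T A_0$ and $S\le_T A_1$), and $\Sigma^0_n(\mathcal{I})$ means $\Sigma^0_n(A_0\oplus A_1)$; the principal ideal $\langle G\rangle$ is presented by the pair $G,G$. A Mathias condition is a pair $(D,S)$ with $D$ finite, $S$ infinite, $\max D<\min S$; $(\widetilde D,\widetilde S)$ extends $(D,S)$ if $D\subseteq\widetilde D\subseteq D\cup S$ and $\widetilde S\subseteq S$. A set $X$ satisfies $(D,S)$ if $D\subseteq X\subseteq D\cup S$; $X$ meets a collection $\mathcal{C}$ of conditions if it satisfies a member of $\mathcal{C}$, and avoids $\mathcal{C}$ if it satisfies a condition with no extension in $\mathcal{C}$. An $\mathcal{I}$-condition is a Mathias condition $(D,S)$ with $S\in\mathcal{I}$. A set $G$ is $n$-$\mathcal{I}$-generic if it meets or avoids every $\Sigma^0_n(\mathcal{I})$-definable collection of $\mathcal{I}$-conditions. *)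

theory Defs
  imports Main "HOL-Library.Nat_Bijection" "HOL-Library.Countable_Set"
begin

text \<open>
  Oracle programs for the unary partial functions on the naturals that are partial recursive
  in a set. Several arguments are passed through the pairing function \<^const>\<open>prod_encode\<close>.
\<close>

datatype prog =
    Zero | Succ | Proj1 | Proj2 | Query
  | Tuple prog prog | Comp prog prog | PRec prog prog | Mu prog

inductive eval :: "nat set \<Rightarrow> prog \<Rightarrow> nat \<Rightarrow> nat \<Rightarrow> bool" for A :: "nat set" where
  eval_Zero: "eval A Zero x 0"
| eval_Succ: "eval A Succ x (Suc x)"
| eval_Proj1: "eval A Proj1 x (fst (prod_decode x))"
| eval_Proj2: "eval A Proj2 x (snd (prod_decode x))"
| eval_Query: "eval A Query x (of_bool (x \<in> A))"
| eval_Tuple: "eval A p x u \<Longrightarrow> eval A q x v \<Longrightarrow> eval A (Tuple p q) x (prod_encode (u, v))"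
| eval_Comp: "eval A q x u \<Longrightarrow> eval A p u v \<Longrightarrow> eval A (Comp p q) x v"
| eval_PRec_0: "eval A p a v \<Longrightarrow> eval A (PRec p q) (prod_encode (a, 0)) v"
| eval_PRec_Suc: "eval A (PRec p q) (prod_encode (a, n)) u \<Longrightarrow>
    eval A q (prod_encode (a, prod_encode (n, u))) v \<Longrightarrow>
    eval A (PRec p q) (prod_encode (a, Suc n)) v"
| eval_Mu: "eval A p (prod_encode (x, n)) 0 \<Longrightarrow>
    (\<And>m. m < n \<Longrightarrow> \<exists>k. eval A p (prod_encode (x, m)) (Suc k)) \<Longrightarrow>
    eval A (Mu p) x n"

lemma eval_deterministic: "eval A p x y \<Longrightarrow> eval A p x z \<Longrightarrow> y = z"
proof (induction arbitrary: z rule: eval.induct)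
  case (eval_Mu p x n)
  from eval_Mu.prems obtain z0: "eval A p (prod_encode (x, z)) 0"
    and zs: "\<And>m. m < z \<Longrightarrow> \<exists>k. eval A p (prod_encode (x, m)) (Suc k)"
    by (auto elim: eval.cases)
  show ?case
  proof (rule linorder_cases[of n z])
    assume "n < z"
    then show ?thesis using zs eval_Mu.IH(1) by blast
  next
    assume "z < n"
    then show ?thesis using eval_Mu.IH(2) z0 by blast
  qed
next
  case (eval_PRec_0 p a v q)
  from eval_PRec_0.prems show ?case
    by (cases rule: eval.cases) (auto intro: eval_PRec_0.IH)
next
  case (eval_PRec_Suc p q a n u v)
  from eval_PRec_Suc.prems show ?case
    by (cases rule: eval.cases) (use eval_PRec_Suc.IH in auto)
next
  case (eval_Tuple p x u q v)
  from eval_Tuple.prems show ?case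
    by (cases rule: eval.cases) (use eval_Tuple.IH in auto)
next
  case (eval_Comp q x u p v)
  from eval_Comp.prems show ?case
    by (cases rule: eval.cases) (use eval_Comp.IH in auto)
qed (auto elim: eval.cases)

definition computes :: "prog \<Rightarrow> nat set \<Rightarrow> nat set \<Rightarrow> bool" where
  "computes p A B \<longleftrightarrow> (\<forall>x. eval A p x (of_bool (x \<in> B)))"

definition turing_le :: "nat set \<Rightarrow> nat set \<Rightarrow> bool" (infix \<open>\<le>\<^sub>T\<close> 50) where
  "B \<le>\<^sub>T A \<longleftrightarrow> (\<exists>p. computes p A B)"

definition turing_join :: "nat set \<Rightarrow> nat set \<Rightarrow> nat set" (infixl \<open>\<oplus>\<^sub>T\<close> 65) where
  "A \<oplus>\<^sub>T B = (\<lambda>x. 2 * x) ` A \<union> (\<lambda>x. 2 * x + 1) ` B"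

text \<open>An effective Goedel numbering of programs.\<close>

primrec prog_code :: "prog \<Rightarrow> nat" where
  "prog_code Zero = prod_encode (0, 0)"
| "prog_code Succ = prod_encode (1, 0)"
| "prog_code Proj1 = prod_encode (2, 0)"
| "prog_code Proj2 = prod_encode (3, 0)"
| "prog_code Query = prod_encode (4, 0)"
| "prog_code (Tuple p q) = prod_encode (5, prod_encode (prog_code p, prog_code q))"
| "prog_code (Comp p q) = prod_encode (6, prod_encode (prog_code p, prog_code q))"
| "prog_code (PRec p q) = prod_encode (7, prod_encode (prog_code p, prog_code q))"
| "prog_code (Mu p) = prod_encode (8, prog_code p)"

lemma inj_prog_code: "inj prog_code"
proof (rule injI)
  show "p = q" if "prog_code p = prog_code q" for p q
    using that by (induction p arbitrary: q) (case_tac q; simp)+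
qed

text \<open>
  The class \<open>\<Sigma>\<^sup>0\<^sub>n(A)\<close>: at a successor level the matrix is the complement
  of a \<open>\<Sigma>\<^sup>0\<^sub>n(A)\<close> set, that is, a \<open>\<Pi>\<^sup>0\<^sub>n(A)\<close> set.
\<close>

primrec Sigma0 :: "nat \<Rightarrow> nat set \<Rightarrow> nat set set" where
  "Sigma0 0 A = {B. B \<le>\<^sub>T A}"
| "Sigma0 (Suc n) A = {{x. \<exists>y. prod_encode (x, y) \<notin> B} | B. B \<in> Sigma0 n A}"

definition turing_ideal :: "nat set set \<Rightarrow> bool" where
  "turing_ideal I \<longleftrightarrow> countable I \<and> I \<noteq> {} \<and>
     (\<forall>X Y. Y \<in> I \<longrightarrow> X \<le>\<^sub>T Y \<longrightarrow> X \<in> I) \<and>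
     (\<forall>X\<in>I. \<forall>Y\<in>I. X \<oplus>\<^sub>T Y \<in> I)"

definition exact_pair :: "nat set set \<Rightarrow> nat set \<Rightarrow> nat set \<Rightarrow> bool" where
  "exact_pair I A0 A1 \<longleftrightarrow> (\<forall>S. S \<in> I \<longleftrightarrow> S \<le>\<^sub>T A0 \<and> S \<le>\<^sub>T A1)"

definition principal_ideal :: "nat set \<Rightarrow> nat set set" where
  "principal_ideal G = {X. X \<le>\<^sub>T G}"

type_synonym cond = "nat set \<times> nat set"

definition mathias_condition :: "cond \<Rightarrow> bool" where
  "mathias_condition = (\<lambda>(D, S). finite D \<and> infinite S \<and> (\<forall>d\<in>D. \<forall>s\<in>S. d < s))"

definition ideal_conditions :: "nat set set \<Rightarrow> cond set" where
  "ideal_conditions I = {(D, S). mathias_condition (D, S) \<and> S \<in> I}"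

definition extends :: "cond \<Rightarrow> cond \<Rightarrow> bool" where
  "extends = (\<lambda>(D', S') (D, S). D \<subseteq> D' \<and> D' \<subseteq> D \<union> S \<and> S' \<subseteq> S)"

definition satisfies :: "nat set \<Rightarrow> cond \<Rightarrow> bool" where
  "satisfies X = (\<lambda>(D, S). D \<subseteq> X \<and> X \<subseteq> D \<union> S)"

definition meets :: "nat set \<Rightarrow> cond set \<Rightarrow> bool" where
  "meets X C \<longleftrightarrow> (\<exists>c\<in>C. satisfies X c)"

text \<open>
  The condition witnessing avoidance is an \<open>I\<close>-condition: with arbitrary reservoirs,
  every infinite \<open>X\<close> without infinite subsets in \<open>I\<close> would avoid every collection of
  \<open>I\<close>-conditions, through \<open>({}, X)\<close>.
\<close>

definition avoids :: "nat set set \<Rightarrow> nat set \<Rightarrow> cond set \<Rightarrow> bool" where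
  "avoids I X C \<longleftrightarrow>
     (\<exists>c\<in>ideal_conditions I. satisfies X c \<and> \<not> (\<exists>c'\<in>C. extends c' c))"

text \<open>
  An index of \<open>(D, S)\<close> with respect to the presentation \<open>A0, A1\<close> consists of the canonical
  index of the finite set \<open>D\<close> and of indices of \<open>S\<close> as a set computable from \<open>A0\<close> and from
  \<open>A1\<close>. A collection is definable at some level if the set of all indices of its members
  belongs to that level.
\<close>

definition cond_indices :: "nat set \<Rightarrow> nat set \<Rightarrow> cond \<Rightarrow> nat set" where
  "cond_indices A0 A1 = (\<lambda>(D, S).
     {prod_encode (set_encode D, prod_encode (prog_code p, prog_code q)) | p q.
        computes p A0 S \<and> computes q A1 S})"

definition Sigma0_definable ::
  "nat \<Rightarrow> nat set set \<Rightarrow> nat set \<Rightarrow> nat set \<Rightarrow> cond set \<Rightarrow> bool" where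
  "Sigma0_definable n I A0 A1 C \<longleftrightarrow>
     C \<subseteq> ideal_conditions I \<and> (\<Union>c\<in>C. cond_indices A0 A1 c) \<in> Sigma0 n (A0 \<oplus>\<^sub>T A1)"

text \<open>\<open>generic n I A0 A1 G\<close>: \<open>G\<close> is \<open>n\<close>-\<open>I\<close>-generic, where \<open>I\<close> is presented by the exact pair \<open>A0, A1\<close>.\<close>

definition generic :: "nat \<Rightarrow> nat set set \<Rightarrow> nat set \<Rightarrow> nat set \<Rightarrow> nat set \<Rightarrow> bool" where
  "generic n I A0 A1 G \<longleftrightarrow>
     (\<forall>C. Sigma0_definable n I A0 A1 C \<longrightarrow> meets G C \<or> avoids I G C)"

lemma exact_pair_principal_ideal: "exact_pair (principal_ideal G) G G"
  by (simp add: exact_pair_def principal_ideal_def)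

end

theory Submission
  imports Defs
begin

text \<open>
  Suppose a program \<open>p\<close> computes \<open>G\<close> from \<open>H\<close>. Genericity of \<open>H\<close> over \<open>G\<close> gives a condition
  \<open>(D, S)\<close> below which \<open>p\<close> never errs about \<open>G\<close> and, on every infinite reservoir computable from \<open>G\<close>,
  answers each question on some finite set. The set \<open>S \<inter> G\<close> is infinite since it almost contains \<open>H\<close>,
  and some program \<open>q\<close> computes it from \<open>G\<close>. Genericity of \<open>G\<close> now gives a condition \<open>(D1, S1)\<close>
  below which both facts persist for every finite approximation \<open>D1 \<union> f\<close> of \<open>G\<close>, with \<open>S \<inter> G\<close>
  replaced by what \<open>q\<close> enumerates from \<open>D1 \<union> f\<close>.

  Fix \<open>x \<in> S1\<close>. The finite sets accepted by \<open>q\<close> over some \<open>f\<close> above \<open>x\<close> can be prolonged forever,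
  so \<open>S1\<close> computes an infinite \<open>R\<close> all of whose finite subsets are of this kind. Over approximations
  containing \<open>x\<close>, the program \<open>p\<close> must answer \<open>x\<close> on some finite \<open>e \<subseteq> R\<close>, and its answer is \<open>1\<close>; but
  \<open>e\<close> is also accepted over an approximation omitting \<open>x\<close>, so the answer is \<open>0\<close>.
\<close>

section \<open>Functions and predicates computable in an oracle\<close>

definition pfst :: "nat \<Rightarrow> nat" where "pfst x = fst (prod_decode x)"
definition psnd :: "nat \<Rightarrow> nat" where "psnd x = snd (prod_decode x)"

abbreviation pair :: "nat \<Rightarrow> nat \<Rightarrow> nat" (\<open>\<langle>_,/ _\<rangle>\<close>) where
  "\<langle>x, y\<rangle> \<equiv> prod_encode (x, y)"

lemma pfst_pair [simp]: "pfst \<langle>x, y\<rangle> = x" and psnd_pair [simp]: "psnd \<langle>x, y\<rangle> = y"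
  by (simp_all add: pfst_def psnd_def)

lemma pair_pfst_psnd [simp]: "\<langle>pfst z, psnd z\<rangle> = z"
  by (simp add: pfst_def psnd_def)

definition computable_in :: "nat set \<Rightarrow> (nat \<Rightarrow> nat) \<Rightarrow> bool" where
  "computable_in A f \<longleftrightarrow> (\<exists>p. \<forall>x. eval A p x (f x))"

definition decidable_in :: "nat set \<Rightarrow> (nat \<Rightarrow> bool) \<Rightarrow> bool" where
  "decidable_in A P \<longleftrightarrow> computable_in A (\<lambda>x. of_bool (P x))"

lemma turing_le_iff_decidable: "X \<le>\<^sub>T A \<longleftrightarrow> decidable_in A (\<lambda>x. x \<in> X)"
  by (simp add: turing_le_def computes_def decidable_in_def computable_in_def)

section \<open>Closure under composition, pairing and primitive recursion\<close>

lemma computable_comp: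
  assumes "computable_in A f" "computable_in A g"
  shows "computable_in A (\<lambda>x. f (g x))"
proof -
  obtain p q where "\<forall>x. eval A p x (f x)" "\<forall>x. eval A q x (g x)"
    using assms by (auto simp: computable_in_def)
  then have "\<forall>x. eval A (Comp p q) x (f (g x))"
    by (auto intro: eval.intros)
  then show ?thesis unfolding computable_in_def by blast
qed

lemma computable_pair:
  assumes "computable_in A f" "computable_in A g"
  shows "computable_in A (\<lambda>x. \<langle>f x, g x\<rangle>)"
proof -
  obtain p q where "\<forall>x. eval A p x (f x)" "\<forall>x. eval A q x (g x)"
    using assms by (auto simp: computable_in_def)
  then have "\<forall>x. eval A (Tuple p q) x \<langle>f x, g x\<rangle>"
    by (auto intro: eval.intros)
  then show ?thesis unfolding computable_in_def by blast
qed

lemma computable_pfst: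
  assumes "computable_in A f" shows "computable_in A (\<lambda>x. pfst (f x))"
  by (rule computable_comp[OF _ assms])
    (auto simp: computable_in_def pfst_def intro: eval_Proj1)

lemma computable_psnd:
  assumes "computable_in A f" shows "computable_in A (\<lambda>x. psnd (f x))"
  by (rule computable_comp[OF _ assms])
    (auto simp: computable_in_def psnd_def intro: eval_Proj2)

lemma computable_Suc:
  assumes "computable_in A f" shows "computable_in A (\<lambda>x. Suc (f x))"
  by (rule computable_comp[OF _ assms]) (auto simp: computable_in_def intro: eval_Succ)

text \<open>The program language has no identity; pairing the two projections rebuilds the
  argument.\<close>

lemma computable_id: "computable_in A (\<lambda>x. x)"
proof -
  have "eval A (Tuple Proj1 Proj2) x \<langle>fst (prod_decode x), snd (prod_decode x)\<rangle>" for x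
    by (intro eval.intros)
  then show ?thesis unfolding computable_in_def by auto
qed

lemma computable_const: "computable_in A (\<lambda>x. c)"
proof (induction c)
  case 0
  show ?case by (auto simp: computable_in_def intro: eval_Zero)
next
  case (Suc c)
  then show ?case by (rule computable_Suc)
qed

lemma computable_comp2:
  assumes "computable_in A (\<lambda>z. h (pfst z) (psnd z))" "computable_in A f" "computable_in A g"
  shows "computable_in A (\<lambda>x. h (f x) (g x))"
  using computable_comp[OF assms(1) computable_pair[OF assms(2,3)]] by simp

text \<open>\<open>h\<close> enters through its recursion equations, so any function known to
  satisfy them can be used; parameter and counter are packed into the single argument
  \<open>z\<close>.\<close>

lemma computable_prec:
  assumes f: "computable_in A f"
    and g: "computable_in A (\<lambda>z. g (pfst z) (pfst (psnd z)) (psnd (psnd z)))"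
    and h0: "\<And>a. h a 0 = f a" and hS: "\<And>a n. h a (Suc n) = g a n (h a n)"
  shows "computable_in A (\<lambda>z. h (pfst z) (psnd z))"
proof -
  obtain p where p: "\<And>x. eval A p x (f x)"
    using f by (auto simp: computable_in_def)
  obtain q where q: "\<And>z. eval A q z (g (pfst z) (pfst (psnd z)) (psnd (psnd z)))"
    using g by (auto simp: computable_in_def)
  have "eval A (PRec p q) \<langle>a, n\<rangle> (h a n)" for a n
  proof (induction n)
    case 0
    show ?case unfolding h0 by (rule eval_PRec_0[OF p])
  next
    case (Suc n)
    have "eval A q \<langle>a, \<langle>n, h a n\<rangle>\<rangle> (g a n (h a n))"
      using q[of "\<langle>a, \<langle>n, h a n\<rangle>\<rangle>"] by simp
    then show ?case unfolding hS by (rule eval_PRec_Suc[OF Suc])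
  qed
  then have "eval A (PRec p q) z (h (pfst z) (psnd z))" for z
    by (metis pair_pfst_psnd)
  then show ?thesis unfolding computable_in_def by blast
qed

lemma computable_if:
  assumes "decidable_in A P" "computable_in A f" "computable_in A g"
  shows "computable_in A (\<lambda>x. if P x then f x else g x)"
proof -
  \<comment> \<open>A case distinction is a recursion on the truth value: \<open>0\<close> yields
    \<open>g\<close>, and one step, ignoring the counter and the earlier value, yields
    \<open>f\<close>.\<close>
  define h where "h a n = (if n = 0 then g a else f a)" for a n :: nat
  have "computable_in A (\<lambda>z. h (pfst z) (psnd z))"
    by (rule computable_prec[where g = "\<lambda>a n u. f a", OF assms(3)])
      (auto simp: h_def intro: computable_comp[OF assms(2) computable_pfst[OF computable_id]])
  from computable_comp2[OF this computable_id assms(1)[unfolded decidable_in_def]]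
  show ?thesis by (rule back_subst[of "computable_in A"]) (auto simp: h_def)
qed

section \<open>Boolean combinations of decidable predicates\<close>

lemma decidable_const: "decidable_in A (\<lambda>x. c)"
  unfolding decidable_in_def by (rule computable_const)

lemma decidable_if:
  assumes "decidable_in A P" "decidable_in A Q" "decidable_in A R"
  shows "decidable_in A (\<lambda>x. if P x then Q x else R x)"
  unfolding decidable_in_def if_distrib[of of_bool]
  using assms by (intro computable_if) (simp_all add: decidable_in_def)

lemma decidable_not:
  assumes "decidable_in A P" shows "decidable_in A (\<lambda>x. \<not> P x)"
  using decidable_if[OF assms decidable_const[of _ False] decidable_const[of _ True]]
  by (rule back_subst[of "decidable_in A"]) auto

lemma decidable_conj:
  assumes "decidable_in A P" "decidable_in A Q" shows "decidable_in A (\<lambda>x. P x \<and> Q x)"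
  using decidable_if[OF assms decidable_const[of _ False]]
  by (rule back_subst[of "decidable_in A"]) auto

lemma decidable_disj:
  assumes "decidable_in A P" "decidable_in A Q" shows "decidable_in A (\<lambda>x. P x \<or> Q x)"
  using decidable_if[OF assms(1) decidable_const[of _ True] assms(2)]
  by (rule back_subst[of "decidable_in A"]) auto

lemma decidable_imp:
  assumes "decidable_in A P" "decidable_in A Q" shows "decidable_in A (\<lambda>x. P x \<longrightarrow> Q x)"
  using decidable_if[OF assms decidable_const[of _ True]]
  by (rule back_subst[of "decidable_in A"]) auto

lemma computable_of_bool:
  "decidable_in A P \<Longrightarrow> computable_in A (\<lambda>x. of_bool (P x))"
  by (simp add: decidable_in_def)

lemma decidable_comp:
  assumes "decidable_in A P" "computable_in A f" shows "decidable_in A (\<lambda>x. P (f x))"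
  unfolding decidable_in_def
  by (rule computable_comp[OF assms(1)[unfolded decidable_in_def] assms(2)])

lemma decidable_comp2:
  assumes "decidable_in A (\<lambda>z. P (pfst z) (psnd z))" "computable_in A f" "computable_in A g"
  shows "decidable_in A (\<lambda>x. P (f x) (g x))"
  using decidable_comp[OF assms(1) computable_pair[OF assms(2,3)]] by simp

lemma decidable_oracle:
  assumes "computable_in A f" shows "decidable_in A (\<lambda>x. f x \<in> A)"
proof (rule decidable_comp[OF _ assms])
  show "decidable_in A (\<lambda>x. x \<in> A)"
    unfolding decidable_in_def computable_in_def by (blast intro: eval_Query)
qed

section \<open>Arithmetic, bounded quantifiers, search and codes of finite sets\<close>

lemma computable_add:
  assumes "computable_in A f" "computable_in A g" shows "computable_in A (\<lambda>x. f x + g x)"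
  by (rule computable_comp2[OF computable_prec[where f = "\<lambda>a. a" and g = "\<lambda>a n u. Suc u"] assms])
    (auto intro!: computable_id computable_Suc computable_psnd)

lemma computable_pred:
  assumes "computable_in A f" shows "computable_in A (\<lambda>x. f x - Suc 0)"
  by (rule computable_comp2[OF computable_prec[where f = "\<lambda>a. 0" and g = "\<lambda>a n u. n"
          and h = "\<lambda>a n. n - Suc 0"] computable_id assms])
    (auto intro!: computable_id computable_const computable_psnd computable_pfst)

lemma computable_diff:
  assumes "computable_in A f" "computable_in A g" shows "computable_in A (\<lambda>x. f x - g x)"
  by (rule computable_comp2[OF computable_prec[where f = "\<lambda>a. a" and g = "\<lambda>a n u. u - Suc 0"] assms])
    (auto intro!: computable_id computable_pred computable_psnd)

lemma decidable_eq_0: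
  assumes "computable_in A f" shows "decidable_in A (\<lambda>x. f x = 0)"
  unfolding decidable_in_def
  by (rule computable_comp2[OF computable_prec[where f = "\<lambda>a. Suc 0" and g = "\<lambda>a n u. 0"
          and h = "\<lambda>a n. of_bool (n = 0)"] computable_id assms])
    (auto intro!: computable_const)

lemma decidable_le:
  assumes "computable_in A f" "computable_in A g" shows "decidable_in A (\<lambda>x. f x \<le> g x)"
  using decidable_eq_0[OF computable_diff[OF assms]] by simp

lemma decidable_less:
  assumes "computable_in A f" "computable_in A g" shows "decidable_in A (\<lambda>x. f x < g x)"
  using decidable_le[OF computable_Suc[OF assms(1)] assms(2)] by (simp add: Suc_le_eq)

lemma decidable_eq:
  fixes f g :: "nat \<Rightarrow> nat"
  assumes "computable_in A f" "computable_in A g" shows "decidable_in A (\<lambda>x. f x = g x)"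
  using decidable_conj[OF decidable_le[OF assms] decidable_le[OF assms(2,1)]]
  by (rule back_subst[of "decidable_in A"]) auto

text \<open>The recursion runs over the bound; its accumulator turns to \<open>1\<close> at the
  first witness and stays there.\<close>

lemma decidable_bex:
  assumes "decidable_in A (\<lambda>z. P (pfst z) (psnd z))" "computable_in A b"
  shows "decidable_in A (\<lambda>x. \<exists>k<b x. P x k)"
  unfolding decidable_in_def
proof (rule computable_comp2[OF computable_prec[where f = "\<lambda>a. 0"
        and g = "\<lambda>a n u. if P a n then Suc 0 else u"] computable_id assms(2)])
  show "computable_in A (\<lambda>z. if P (pfst z) (pfst (psnd z)) then Suc 0 else psnd (psnd z))"
    by (intro computable_if decidable_comp2[OF assms(1)] computable_const computable_pfst
        computable_psnd computable_id)
qed (auto simp: less_Suc_eq intro: computable_const)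

lemma decidable_ball:
  assumes "decidable_in A (\<lambda>z. P (pfst z) (psnd z))" "computable_in A b"
  shows "decidable_in A (\<lambda>x. \<forall>k<b x. P x k)"
  using decidable_not[OF decidable_bex[OF decidable_not[OF assms(1)] assms(2)]] by simp

lemma computable_Least:
  assumes "decidable_in A (\<lambda>z. P (pfst z) (psnd z))" and ex: "\<And>x. \<exists>k. P x k"
  shows "computable_in A (\<lambda>x. LEAST k. P x k)"
proof -
  \<comment> \<open>\<open>Mu\<close> searches for the value \<open>0\<close>, hence the program for
    the negation.\<close>
  obtain p where p: "\<And>z. eval A p z (of_bool (\<not> P (pfst z) (psnd z)))"
    using decidable_not[OF assms(1)] by (auto simp: decidable_in_def computable_in_def)
  have "eval A (Mu p) x (LEAST k. P x k)" for x
  proof (rule eval_Mu)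
    show "eval A p \<langle>x, LEAST k. P x k\<rangle> 0"
      using p[of "\<langle>x, LEAST k. P x k\<rangle>"] LeastI_ex[OF ex[of x]] by simp
    show "\<exists>k. eval A p \<langle>x, m\<rangle> (Suc k)" if "m < (LEAST k. P x k)" for m
      using p[of "\<langle>x, m\<rangle>"] not_less_Least[OF that] by auto
  qed
  then show ?thesis unfolding computable_in_def by blast
qed

lemma decidable_odd:
  assumes "computable_in A f" shows "decidable_in A (\<lambda>x. odd (f x))"
  unfolding decidable_in_def
  by (rule computable_comp2[OF computable_prec[where f = "\<lambda>a. 0" and g = "\<lambda>a n u. Suc 0 - u"
          and h = "\<lambda>a n. of_bool (odd n)"] computable_id assms])
    (auto intro!: computable_const computable_diff computable_psnd computable_id)

lemma computable_half:
  assumes "computable_in A f" shows "computable_in A (\<lambda>x. f x div 2)"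
proof (rule computable_comp2[OF computable_prec[where f = "\<lambda>a. 0"
        and g = "\<lambda>a n u. if odd n then Suc u else u" and h = "\<lambda>a n. n div 2"] computable_id assms])
  show "computable_in A
      (\<lambda>z. if odd (pfst (psnd z)) then Suc (psnd (psnd z)) else psnd (psnd z))"
    by (intro computable_if decidable_odd computable_Suc computable_pfst computable_psnd
        computable_id)
qed (auto intro: computable_const)

lemma computable_power2:
  assumes "computable_in A f" shows "computable_in A (\<lambda>x. 2 ^ f x)"
  by (rule computable_comp2[OF computable_prec[where f = "\<lambda>a. 1" and g = "\<lambda>a n u. u + u"
          and h = "\<lambda>a n. 2 ^ n"] computable_id assms])
    (auto intro!: computable_const computable_add computable_psnd computable_id)

lemma decidable_set_decode:
  assumes "computable_in A f" "computable_in A g"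
  shows "decidable_in A (\<lambda>x. g x \<in> set_decode (f x))"
proof -
  \<comment> \<open>Repeated halving shifts the wanted bit to the end, where its parity can be
    read.\<close>
  have "computable_in A (\<lambda>z. pfst z div 2 ^ psnd z)"
  proof (rule computable_prec[where f = "\<lambda>a. a" and g = "\<lambda>a n u. u div 2"])
    show "a div 2 ^ Suc n = a div 2 ^ n div 2" for a n :: nat
      by (metis div_mult2_eq power_Suc2)
  qed (auto intro!: computable_id computable_half computable_psnd)
  from decidable_odd[OF computable_comp2[OF this assms]]
  show ?thesis by (simp add: set_decode_def)
qed

lemmas computability_intros =
  computable_pair computable_pfst computable_psnd computable_Suc computable_add
  computable_power2 computable_of_bool computable_id computable_const
  decidable_not decidable_conj decidable_disj decidable_imp decidable_eq decidable_less
  decidable_le decidable_bex decidable_ball decidable_set_decode decidable_const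

section \<open>Oracle substitution and transitivity of Turing reducibility\<close>

primrec subst_query :: "prog \<Rightarrow> prog \<Rightarrow> prog" where
  "subst_query r Zero = Zero"
| "subst_query r Succ = Succ"
| "subst_query r Proj1 = Proj1"
| "subst_query r Proj2 = Proj2"
| "subst_query r Query = r"
| "subst_query r (Tuple p q) = Tuple (subst_query r p) (subst_query r q)"
| "subst_query r (Comp p q) = Comp (subst_query r p) (subst_query r q)"
| "subst_query r (PRec p q) = PRec (subst_query r p) (subst_query r q)"
| "subst_query r (Mu p) = Mu (subst_query r p)"

lemma eval_subst_query:
  assumes "computes r A B" "eval B p x y"
  shows "eval A (subst_query r p) x y"
  using assms(2)
proof induction
  case (eval_Query x)
  show ?case using assms(1) unfolding computes_def subst_query.simps by blast
next
  case (eval_PRec_Suc p q a n u v)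
  then show ?case by (auto intro: eval.eval_PRec_Suc)
next
  case (eval_Mu p x n)
  then show ?case by (auto intro!: eval.eval_Mu)
qed (auto intro: eval.intros)

lemma turing_le_trans:
  assumes "X \<le>\<^sub>T B" "B \<le>\<^sub>T A" shows "X \<le>\<^sub>T A"
proof -
  obtain p r where "computes p B X" "computes r A B"
    using assms by (auto simp: turing_le_def)
  then have "computes (subst_query r p) A X"
    unfolding computes_def[of _ _ X] using eval_subst_query by blast
  then show ?thesis unfolding turing_le_def by blast
qed

section \<open>The arithmetical hierarchy\<close>

text \<open>Predicates instead of sets allow the complexity of a formula to be established by
  introduction rules following its syntax.\<close>

definition is_Sigma :: "nat \<Rightarrow> nat set \<Rightarrow> (nat \<Rightarrow> bool) \<Rightarrow> bool" where
  "is_Sigma n A P \<longleftrightarrow> {x. P x} \<in> Sigma0 n A"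

definition is_Pi :: "nat \<Rightarrow> nat set \<Rightarrow> (nat \<Rightarrow> bool) \<Rightarrow> bool" where
  "is_Pi n A P \<longleftrightarrow> is_Sigma n A (\<lambda>x. \<not> P x)"

lemma is_Sigma_0 [simp]: "is_Sigma 0 A P \<longleftrightarrow> decidable_in A P"
  by (simp add: is_Sigma_def turing_le_iff_decidable)

lemma is_Sigma_Suc:
  "is_Sigma (Suc n) A P \<longleftrightarrow> (\<exists>Q. is_Pi n A Q \<and> (\<forall>x. P x \<longleftrightarrow> (\<exists>y. Q \<langle>x, y\<rangle>)))"
proof
  assume "is_Sigma (Suc n) A P"
  then obtain B where "B \<in> Sigma0 n A" "{x. P x} = {x. \<exists>y. \<langle>x, y\<rangle> \<notin> B}"
    by (auto simp: is_Sigma_def)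
  then show "\<exists>Q. is_Pi n A Q \<and> (\<forall>x. P x \<longleftrightarrow> (\<exists>y. Q \<langle>x, y\<rangle>))"
    by (intro exI[of _ "\<lambda>z. z \<notin> B"]) (auto simp: is_Pi_def is_Sigma_def)
next
  assume "\<exists>Q. is_Pi n A Q \<and> (\<forall>x. P x \<longleftrightarrow> (\<exists>y. Q \<langle>x, y\<rangle>))"
  then obtain Q where "is_Pi n A Q" "\<forall>x. P x \<longleftrightarrow> (\<exists>y. Q \<langle>x, y\<rangle>)" by blast
  then show "is_Sigma (Suc n) A P"
    by (auto simp: is_Pi_def is_Sigma_def intro!: exI[of _ "{z. \<not> Q z}"])
qed

lemma is_Pi_not: "is_Sigma n A P \<Longrightarrow> is_Pi n A (\<lambda>x. \<not> P x)"
  by (simp add: is_Pi_def)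

lemma is_Sigma_comp:
  assumes "is_Sigma n A P" "computable_in A f" shows "is_Sigma n A (\<lambda>x. P (f x))"
  using assms
proof (induction n arbitrary: P f)
  case 0
  then show ?case by (simp add: decidable_comp)
next
  case (Suc n)
  then obtain Q where Q: "is_Pi n A Q" "\<And>x. P x \<longleftrightarrow> (\<exists>y. Q \<langle>x, y\<rangle>)"
    by (auto simp: is_Sigma_Suc)
  have "computable_in A (\<lambda>z. \<langle>f (pfst z), psnd z\<rangle>)"
    by (intro computability_intros computable_comp[OF Suc.prems(2)])
  with Q(1) have "is_Pi n A (\<lambda>z. Q \<langle>f (pfst z), psnd z\<rangle>)"
    unfolding is_Pi_def by (rule Suc.IH)
  then show ?case unfolding is_Sigma_Suc
    by (intro exI[of _ "\<lambda>z. Q \<langle>f (pfst z), psnd z\<rangle>"]) (simp add: Q(2))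
qed

lemma is_Pi_comp:
  assumes "is_Pi n A P" "computable_in A f" shows "is_Pi n A (\<lambda>x. P (f x))"
  using assms unfolding is_Pi_def by (rule is_Sigma_comp)

lemma is_Sigma_Suc_if_is_Pi:
  assumes "is_Pi n A P" shows "is_Sigma (Suc n) A P"
proof -
  have "is_Pi n A (\<lambda>z. P (pfst z))"
    by (intro is_Pi_comp[OF assms] computability_intros)
  then show ?thesis unfolding is_Sigma_Suc by (intro exI[of _ "\<lambda>z. P (pfst z)"]) simp
qed

lemma is_Pi_Suc_if_is_Sigma: "is_Sigma n A P \<Longrightarrow> is_Pi (Suc n) A P"
  unfolding is_Pi_def by (rule is_Sigma_Suc_if_is_Pi) (rule is_Pi_not)

lemma is_Sigma_lift: "is_Sigma n A P \<Longrightarrow> is_Sigma (Suc n) A P"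
proof (induction n arbitrary: P)
  case 0
  then show ?case
    by (auto intro!: is_Sigma_Suc_if_is_Pi simp: is_Pi_def intro: decidable_not)
next
  case (Suc n)
  then obtain Q where "is_Pi n A Q" "\<And>x. P x \<longleftrightarrow> (\<exists>y. Q \<langle>x, y\<rangle>)"
    by (auto simp: is_Sigma_Suc)
  moreover from this(1) have "is_Pi (Suc n) A Q"
    unfolding is_Pi_def by (rule Suc.IH)
  ultimately show ?case unfolding is_Sigma_Suc[of "Suc n"] by blast
qed

lemma is_Pi_lift: "is_Pi n A P \<Longrightarrow> is_Pi (Suc n) A P"
  unfolding is_Pi_def by (rule is_Sigma_lift)

text \<open>Both closures are proved together: negating the matrix exchanges conjunction and
  disjunction, so each uses the other one level below. A conjunction needs a pair of witnesses,
  while a disjunction can share one.\<close>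

lemma is_Sigma_conj_disj:
  assumes "is_Sigma n A P" "is_Sigma n A Q"
  shows "is_Sigma n A (\<lambda>x. P x \<and> Q x) \<and> is_Sigma n A (\<lambda>x. P x \<or> Q x)"
  using assms
proof (induction n arbitrary: P Q)
  case 0
  then show ?case by (auto intro: decidable_conj decidable_disj)
next
  case (Suc n)
  obtain P' where P': "is_Pi n A P'" "\<And>x. P x \<longleftrightarrow> (\<exists>y. P' \<langle>x, y\<rangle>)"
    using Suc.prems by (auto simp: is_Sigma_Suc)
  obtain Q' where Q': "is_Pi n A Q'" "\<And>x. Q x \<longleftrightarrow> (\<exists>y. Q' \<langle>x, y\<rangle>)"
    using Suc.prems by (auto simp: is_Sigma_Suc)
  have "is_Pi n A (\<lambda>z. P' \<langle>pfst z, pfst (psnd z)\<rangle>)"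
    by (intro is_Pi_comp[OF P'(1)] computability_intros)
  moreover have "is_Pi n A (\<lambda>z. Q' \<langle>pfst z, psnd (psnd z)\<rangle>)"
    by (intro is_Pi_comp[OF Q'(1)] computability_intros)
  ultimately have "is_Pi n A (\<lambda>z. P' \<langle>pfst z, pfst (psnd z)\<rangle> \<and> Q' \<langle>pfst z, psnd (psnd z)\<rangle>)"
    using Suc.IH unfolding is_Pi_def de_Morgan_conj by blast
  moreover have "(P x \<and> Q x) \<longleftrightarrow> (\<exists>y. P' \<langle>x, pfst y\<rangle> \<and> Q' \<langle>x, psnd y\<rangle>)" for x
    unfolding P'(2) Q'(2) by (metis pfst_pair psnd_pair)
  ultimately have "is_Sigma (Suc n) A (\<lambda>x. P x \<and> Q x)"
    unfolding is_Sigma_Suc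
    by (intro exI[of _ "\<lambda>z. P' \<langle>pfst z, pfst (psnd z)\<rangle> \<and> Q' \<langle>pfst z, psnd (psnd z)\<rangle>"]) simp
  moreover have "is_Pi n A (\<lambda>z. P' z \<or> Q' z)"
    using Suc.IH P'(1) Q'(1) unfolding is_Pi_def de_Morgan_disj by blast
  then have "is_Sigma (Suc n) A (\<lambda>x. P x \<or> Q x)"
    unfolding is_Sigma_Suc by (intro exI[of _ "\<lambda>z. P' z \<or> Q' z"]) (auto simp: P'(2) Q'(2))
  ultimately show ?case by blast
qed

lemma is_Sigma_conj: "is_Sigma n A P \<Longrightarrow> is_Sigma n A Q \<Longrightarrow> is_Sigma n A (\<lambda>x. P x \<and> Q x)"
  and is_Sigma_disj: "is_Sigma n A P \<Longrightarrow> is_Sigma n A Q \<Longrightarrow> is_Sigma n A (\<lambda>x. P x \<or> Q x)"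
  and is_Pi_conj: "is_Pi n A P \<Longrightarrow> is_Pi n A Q \<Longrightarrow> is_Pi n A (\<lambda>x. P x \<and> Q x)"
  and is_Pi_disj: "is_Pi n A P \<Longrightarrow> is_Pi n A Q \<Longrightarrow> is_Pi n A (\<lambda>x. P x \<or> Q x)"
  using is_Sigma_conj_disj[of n A P Q] is_Sigma_conj_disj[of n A "\<lambda>x. \<not> P x" "\<lambda>x. \<not> Q x"]
  by (simp_all add: is_Pi_def)

lemma is_Pi_imp:
  assumes "is_Sigma n A P" "is_Pi n A Q" shows "is_Pi n A (\<lambda>x. P x \<longrightarrow> Q x)"
  using is_Pi_disj[OF is_Pi_not[OF assms(1)] assms(2)] by simp

lemma is_Sigma_ex:
  assumes "is_Sigma (Suc n) A (\<lambda>z. P (pfst z) (psnd z))"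
  shows "is_Sigma (Suc n) A (\<lambda>x. \<exists>k. P x k)"
proof -
  obtain Q where Q: "is_Pi n A Q" "\<And>z. P (pfst z) (psnd z) \<longleftrightarrow> (\<exists>y. Q \<langle>z, y\<rangle>)"
    using assms by (auto simp: is_Sigma_Suc)
  have P: "P x k \<longleftrightarrow> (\<exists>y. Q \<langle>\<langle>x, k\<rangle>, y\<rangle>)" for x k
    using Q(2)[of "\<langle>x, k\<rangle>"] by simp
  have "is_Pi n A (\<lambda>z. Q \<langle>\<langle>pfst z, pfst (psnd z)\<rangle>, psnd (psnd z)\<rangle>)"
    by (intro is_Pi_comp[OF Q(1)] computability_intros)
  moreover have "(\<exists>k. P x k) \<longleftrightarrow> (\<exists>y. Q \<langle>\<langle>x, pfst y\<rangle>, psnd y\<rangle>)" for x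
    unfolding P by (metis pfst_pair psnd_pair)
  ultimately show ?thesis unfolding is_Sigma_Suc
    by (intro exI[of _ "\<lambda>z. Q \<langle>\<langle>pfst z, pfst (psnd z)\<rangle>, psnd (psnd z)\<rangle>"]) simp
qed

lemma is_Pi_all:
  assumes "is_Pi (Suc n) A (\<lambda>z. P (pfst z) (psnd z))"
  shows "is_Pi (Suc n) A (\<lambda>x. \<forall>k. P x k)"
  using is_Sigma_ex[OF assms[unfolded is_Pi_def]] by (simp add: is_Pi_def)

lemma is_Sigma_if_decidable: "decidable_in A P \<Longrightarrow> is_Sigma n A P"
  by (induction n) (auto intro: is_Sigma_lift)

lemma is_Pi_if_decidable: "decidable_in A P \<Longrightarrow> is_Pi n A P"
  unfolding is_Pi_def by (intro is_Sigma_if_decidable decidable_not)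

lemma is_Sigma_1_iff:
  "is_Sigma (Suc 0) A P \<longleftrightarrow> (\<exists>Q. decidable_in A Q \<and> (\<forall>x. P x \<longleftrightarrow> (\<exists>y. Q \<langle>x, y\<rangle>)))"
proof -
  have "is_Pi 0 A Q \<longleftrightarrow> decidable_in A Q" for Q
    using decidable_not[of A Q] decidable_not[of A "\<lambda>x. \<not> Q x"] by (auto simp: is_Pi_def)
  then show ?thesis by (simp add: is_Sigma_Suc)
qed

text \<open>Finitely many witnesses have a common bound \<open>w\<close>, so the unbounded
  quantifier moves in front of the bounded one.\<close>

lemma is_Sigma_1_ball:
  assumes "is_Sigma (Suc 0) A (\<lambda>z. P (pfst z) (psnd z))" "computable_in A b"
  shows "is_Sigma (Suc 0) A (\<lambda>x. \<forall>k<b x. P x k)"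
proof -
  obtain Q where Q: "decidable_in A Q" "\<And>z. P (pfst z) (psnd z) \<longleftrightarrow> (\<exists>y. Q \<langle>z, y\<rangle>)"
    using assms(1) by (auto simp: is_Sigma_1_iff)
  have P: "P x k \<longleftrightarrow> (\<exists>y. Q \<langle>\<langle>x, k\<rangle>, y\<rangle>)" for x k
    using Q(2)[of "\<langle>x, k\<rangle>"] by simp
  have "decidable_in A (\<lambda>z. \<forall>k<b (pfst z). \<exists>y<psnd z. Q \<langle>\<langle>pfst z, k\<rangle>, y\<rangle>)"
    by (intro computability_intros decidable_comp[OF Q(1)] computable_comp[OF assms(2)])
  moreover have "(\<forall>k<b x. P x k) \<longleftrightarrow> (\<exists>w. \<forall>k<b x. \<exists>y<w. Q \<langle>\<langle>x, k\<rangle>, y\<rangle>)" for x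
  proof
    assume "\<forall>k<b x. P x k"
    then obtain y where y: "\<forall>k<b x. Q \<langle>\<langle>x, k\<rangle>, y k\<rangle>"
      unfolding P by metis
    have "y k < Suc (Max (y ` {..<b x}))" if "k < b x" for k
      using that by (intro le_imp_less_Suc Max_ge) auto
    with y show "\<exists>w. \<forall>k<b x. \<exists>y<w. Q \<langle>\<langle>x, k\<rangle>, y\<rangle>" by blast
  qed (use P in blast)
  ultimately show ?thesis unfolding is_Sigma_1_iff
    by (intro exI[of _ "\<lambda>z. \<forall>k<b (pfst z). \<exists>y<psnd z. Q \<langle>\<langle>pfst z, k\<rangle>, y\<rangle>"]) simp
qed

section \<open>Evaluation is uniformly \<open>\<Sigma>\<^sup>0\<^sub>1\<close>\<close>

text \<open>
  A triple \<open>\<langle>c, \<langle>x, y\<rangle>\<rangle>\<close> stands for the fact that the program with code \<open>c\<close> maps \<open>x\<close> to \<open>y\<close>.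
  Each rule of \<^const>\<open>eval\<close> passes to a subprogram or, for \<^const>\<open>PRec\<close>, to a smaller argument,
  so a set of facts each of which follows by a rule from facts in the set cannot be circular:
  it consists of true facts. No derivation order has to be recorded.
\<close>

definition follows :: "nat set \<Rightarrow> nat set \<Rightarrow> nat \<Rightarrow> nat \<Rightarrow> nat \<Rightarrow> bool" where
  "follows X T c x y \<longleftrightarrow>
     pfst c = 0 \<and> y = 0
   \<or> pfst c = 1 \<and> y = Suc x
   \<or> pfst c = 2 \<and> y = pfst x
   \<or> pfst c = 3 \<and> y = psnd x
   \<or> pfst c = 4 \<and> y = of_bool (x \<in> X)
   \<or> pfst c = 5 \<and> \<langle>pfst (psnd c), \<langle>x, pfst y\<rangle>\<rangle> \<in> T \<and> \<langle>psnd (psnd c), \<langle>x, psnd y\<rangle>\<rangle> \<in> T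
   \<or> pfst c = 6 \<and> (\<exists>u. \<langle>psnd (psnd c), \<langle>x, u\<rangle>\<rangle> \<in> T \<and> \<langle>pfst (psnd c), \<langle>u, y\<rangle>\<rangle> \<in> T)
   \<or> pfst c = 7 \<and> psnd x = 0 \<and> \<langle>pfst (psnd c), \<langle>pfst x, y\<rangle>\<rangle> \<in> T
   \<or> pfst c = 7 \<and> (\<exists>n u. psnd x = Suc n \<and> \<langle>c, \<langle>\<langle>pfst x, n\<rangle>, u\<rangle>\<rangle> \<in> T \<and>
       \<langle>psnd (psnd c), \<langle>\<langle>pfst x, \<langle>n, u\<rangle>\<rangle>, y\<rangle>\<rangle> \<in> T)
   \<or> pfst c = 8 \<and> \<langle>psnd c, \<langle>\<langle>x, y\<rangle>, 0\<rangle>\<rangle> \<in> T \<and>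
       (\<forall>m<y. \<exists>k. \<langle>psnd c, \<langle>\<langle>x, m\<rangle>, Suc k\<rangle>\<rangle> \<in> T)"

definition derivation :: "nat set \<Rightarrow> nat set \<Rightarrow> bool" where
  "derivation X T \<longleftrightarrow> (\<forall>c x y. \<langle>c, \<langle>x, y\<rangle>\<rangle> \<in> T \<longrightarrow> follows X T c x y)"

lemma follows_mono: "follows X T c x y \<Longrightarrow> T \<subseteq> T' \<Longrightarrow> follows X T' c x y"
  unfolding follows_def by (elim disj_forward conj_forward ex_forward all_forward imp_forward) auto

lemma derivation_Union: "(\<And>T. T \<in> \<T> \<Longrightarrow> derivation X T) \<Longrightarrow> derivation X (\<Union>\<T>)"
  unfolding derivation_def by (meson Union_iff Union_upper follows_mono)

lemma derivation_Un: "derivation X T \<Longrightarrow> derivation X T' \<Longrightarrow> derivation X (T \<union> T')"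
  using derivation_Union[of "{T, T'}" X] by auto

lemma derivation_insert:
  "derivation X T \<Longrightarrow> follows X T c x y \<Longrightarrow> derivation X (insert \<langle>c, \<langle>x, y\<rangle>\<rangle> T)"
  unfolding derivation_def by (auto intro: follows_mono)

lemma derivation_axiom:
  assumes "follows X {} c x y"
  shows "\<exists>T. finite T \<and> derivation X T \<and> \<langle>c, \<langle>x, y\<rangle>\<rangle> \<in> T"
  using derivation_insert[OF _ assms] by (intro exI[of _ "{\<langle>c, \<langle>x, y\<rangle>\<rangle>}"]) (simp add: derivation_def)

lemma followsD: "derivation X T \<Longrightarrow> \<langle>c, \<langle>x, y\<rangle>\<rangle> \<in> T \<Longrightarrow> follows X T c x y"
  by (simp add: derivation_def)

lemma eval_if_derivation:
  assumes T: "derivation X T"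
  shows "\<langle>prog_code p, \<langle>x, y\<rangle>\<rangle> \<in> T \<Longrightarrow> eval X p x y"
proof (induction p arbitrary: x y)
  case (Tuple p q)
  from followsD[OF T this(3)]
  have "\<langle>prog_code p, \<langle>x, pfst y\<rangle>\<rangle> \<in> T" "\<langle>prog_code q, \<langle>x, psnd y\<rangle>\<rangle> \<in> T"
    by (simp_all add: follows_def)
  then have "eval X (Tuple p q) x \<langle>pfst y, psnd y\<rangle>"
    by (intro eval_Tuple Tuple.IH)
  then show ?case by simp
next
  case (Comp p q)
  from followsD[OF T this(3)]
  obtain u where "\<langle>prog_code q, \<langle>x, u\<rangle>\<rangle> \<in> T" "\<langle>prog_code p, \<langle>u, y\<rangle>\<rangle> \<in> T"
    by (auto simp: follows_def)
  from eval_Comp[OF Comp.IH(2)[OF this(1)] Comp.IH(1)[OF this(2)]] show ?case .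
next
  case (PRec p q)
  \<comment> \<open>A fact about \<open>PRec p q\<close> may rest on another fact about the same
    program; an inner induction on the counter takes over where the structural one does not
    descend.\<close>
  have "\<langle>prog_code (PRec p q), \<langle>\<langle>a, n\<rangle>, y\<rangle>\<rangle> \<in> T \<Longrightarrow> eval X (PRec p q) \<langle>a, n\<rangle> y" for a n y
  proof (induction n arbitrary: y)
    case 0
    from followsD[OF T this] have "\<langle>prog_code p, \<langle>a, y\<rangle>\<rangle> \<in> T"
      by (simp add: follows_def)
    then show ?case by (intro eval_PRec_0 PRec.IH)
  next
    case (Suc n)
    then have "follows X T (prog_code (PRec p q)) \<langle>a, Suc n\<rangle> y"
      using followsD[OF T] by blast
    then obtain u where "\<langle>prog_code (PRec p q), \<langle>\<langle>a, n\<rangle>, u\<rangle>\<rangle> \<in> T"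
        "\<langle>prog_code q, \<langle>\<langle>a, \<langle>n, u\<rangle>\<rangle>, y\<rangle>\<rangle> \<in> T"
      by (auto simp: follows_def)
    from eval_PRec_Suc[OF Suc.IH[OF this(1)] PRec.IH(2)[OF this(2)]] show ?case .
  qed
  from this[of "pfst x" "psnd x"] PRec.prems show ?case by simp
next
  case (Mu p)
  then have "follows X T (prog_code (Mu p)) x y"
    using followsD[OF T] by blast
  then have "\<langle>prog_code p, \<langle>\<langle>x, y\<rangle>, 0\<rangle>\<rangle> \<in> T" "\<forall>m<y. \<exists>k. \<langle>prog_code p, \<langle>\<langle>x, m\<rangle>, Suc k\<rangle>\<rangle> \<in> T"
    by (auto simp: follows_def)
  with Mu.IH show ?case by (intro eval_Mu) blast+
next
  case Query
  from followsD[OF T this] have "y = of_bool (x \<in> X)" by (simp add: follows_def)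
  then show ?case using eval_Query[of X x] by simp
next
  case Zero
  from followsD[OF T this] have "y = 0" by (simp add: follows_def)
  then show ?case by (simp add: eval_Zero)
next
  case Succ
  from followsD[OF T this] have "y = Suc x" by (simp add: follows_def)
  then show ?case by (simp add: eval_Succ)
next
  case Proj1
  from followsD[OF T this] have "y = pfst x" by (simp add: follows_def)
  then show ?case by (simp add: eval_Proj1 pfst_def)
next
  case Proj2
  from followsD[OF T this] have "y = psnd x" by (simp add: follows_def)
  then show ?case by (simp add: eval_Proj2 psnd_def)
qed

text \<open>Each application of a rule has finitely many premises, even for \<open>Mu\<close>, where
  there is one for each argument up to \<open>n\<close>; merging their derivations keeps the set
  finite.\<close>

lemma derivation_if_eval:
  "eval X p x y \<Longrightarrow> \<exists>T. finite T \<and> derivation X T \<and> \<langle>prog_code p, \<langle>x, y\<rangle>\<rangle> \<in> T"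
proof (induction rule: eval.induct)
  case (eval_Tuple p x u q v)
  then obtain T T' where T: "finite T" "derivation X T" "\<langle>prog_code p, \<langle>x, u\<rangle>\<rangle> \<in> T"
      "finite T'" "derivation X T'" "\<langle>prog_code q, \<langle>x, v\<rangle>\<rangle> \<in> T'"
    by blast
  then have "follows X (T \<union> T') (prog_code (Tuple p q)) x \<langle>u, v\<rangle>"
    by (simp add: follows_def)
  with T show ?case by (meson derivation_insert derivation_Un finite.insertI finite_UnI insertI1)
next
  case (eval_Comp q x u p v)
  then obtain T T' where T: "finite T" "derivation X T" "\<langle>prog_code q, \<langle>x, u\<rangle>\<rangle> \<in> T"
      "finite T'" "derivation X T'" "\<langle>prog_code p, \<langle>u, v\<rangle>\<rangle> \<in> T'"
    by blast
  then have "follows X (T \<union> T') (prog_code (Comp p q)) x v"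
    by (auto simp: follows_def)
  with T show ?case by (meson derivation_insert derivation_Un finite.insertI finite_UnI insertI1)
next
  case (eval_PRec_0 p a v q)
  then obtain T where T: "finite T" "derivation X T" "\<langle>prog_code p, \<langle>a, v\<rangle>\<rangle> \<in> T"
    by blast
  then have "follows X T (prog_code (PRec p q)) \<langle>a, 0\<rangle> v"
    by (simp add: follows_def)
  with T show ?case by (meson derivation_insert finite.insertI insertI1)
next
  case (eval_PRec_Suc p q a n u v)
  then obtain T T' where T: "finite T" "derivation X T"
      "\<langle>prog_code (PRec p q), \<langle>\<langle>a, n\<rangle>, u\<rangle>\<rangle> \<in> T"
      "finite T'" "derivation X T'" "\<langle>prog_code q, \<langle>\<langle>a, \<langle>n, u\<rangle>\<rangle>, v\<rangle>\<rangle> \<in> T'"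
    by blast
  then have "follows X (T \<union> T') (prog_code (PRec p q)) \<langle>a, Suc n\<rangle> v"
    by (auto simp: follows_def)
  with T show ?case by (meson derivation_insert derivation_Un finite.insertI finite_UnI insertI1)
next
  case (eval_Mu p x n)
  obtain T where T: "finite T" "derivation X T" "\<langle>prog_code p, \<langle>\<langle>x, n\<rangle>, 0\<rangle>\<rangle> \<in> T"
    using eval_Mu.IH(1) by blast
  have "\<forall>m. \<exists>T. m < n \<longrightarrow> finite T \<and> derivation X T \<and>
      (\<exists>k. \<langle>prog_code p, \<langle>\<langle>x, m\<rangle>, Suc k\<rangle>\<rangle> \<in> T)"
    using eval_Mu.IH(2) by blast
  then obtain S where S: "\<And>m. m < n \<Longrightarrow> finite (S m) \<and> derivation X (S m) \<and>
      (\<exists>k. \<langle>prog_code p, \<langle>\<langle>x, m\<rangle>, Suc k\<rangle>\<rangle> \<in> S m)"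
    by metis
  let ?T = "T \<union> \<Union>(S ` {..<n})"
  have "derivation X ?T"
    using S T(2) by (intro derivation_Un derivation_Union) auto
  moreover have "follows X ?T (prog_code (Mu p)) x n"
    using S T(3) by (fastforce simp: follows_def)
  moreover have "finite ?T" using S T(1) by auto
  ultimately show ?case by (meson derivation_insert finite.insertI insertI1)
qed (rule derivation_axiom, simp add: follows_def pfst_def psnd_def)+

section \<open>The universal predicate and the use principle\<close>

text \<open>The search for \<open>t\<close> is the only unbounded one. The predicate makes sense for
  every number \<open>c\<close>, including those that code no program.\<close>

definition universal :: "nat set \<Rightarrow> nat \<Rightarrow> nat \<Rightarrow> nat \<Rightarrow> bool" where
  "universal X c x y \<longleftrightarrow> (\<exists>t. derivation X (set_decode t) \<and> \<langle>c, \<langle>x, y\<rangle>\<rangle> \<in> set_decode t)"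

lemma universal_prog_code [simp]: "universal X (prog_code p) x y \<longleftrightarrow> eval X p x y"
proof
  assume "eval X p x y"
  then obtain T where "finite T" "derivation X T" "\<langle>prog_code p, \<langle>x, y\<rangle>\<rangle> \<in> T"
    using derivation_if_eval by blast
  then show "universal X (prog_code p) x y"
    unfolding universal_def by (intro exI[of _ "set_encode T"]) simp
qed (auto simp: universal_def intro: eval_if_derivation)

lemma less_if_in_set_decode:
  assumes "x \<in> set_decode t" shows "x < t"
proof -
  have "2 ^ x \<le> t"
    using assms by (auto simp: set_decode_def intro: ccontr)
  then show ?thesis by (meson less_exp less_le_trans)
qed

lemma fact_bounds:
  assumes "\<langle>c, \<langle>x, y\<rangle>\<rangle> \<in> set_decode t" shows "c < t" "x < t" "y < t"
  using less_if_in_set_decode[OF assms] le_prod_encode_1[of c "\<langle>x, y\<rangle>"]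
    le_prod_encode_2[of "\<langle>x, y\<rangle>" c] le_prod_encode_1[of x y] le_prod_encode_2[of y x]
  by linarith+

text \<open>This is the use principle. A query is itself a fact of the derivation, so its argument
  lies below the code \<open>t\<close>, and oracles agreeing below \<open>t\<close> validate the
  same derivation.\<close>

lemma eval_use:
  assumes "eval X p x y"
  shows "\<exists>m. \<forall>X'. (\<forall>z<m. z \<in> X' \<longleftrightarrow> z \<in> X) \<longrightarrow> eval X' p x y"
proof -
  obtain t where t: "derivation X (set_decode t)" "\<langle>prog_code p, \<langle>x, y\<rangle>\<rangle> \<in> set_decode t"
    using assms unfolding universal_prog_code[symmetric] universal_def by blast
  have "eval X' p x y" if "\<forall>z<t. z \<in> X' \<longleftrightarrow> z \<in> X" for X'
  proof (rule eval_if_derivation[OF _ t(2)], unfold derivation_def, intro allI impI)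
    fix c x y assume *: "\<langle>c, \<langle>x, y\<rangle>\<rangle> \<in> set_decode t"
    then have "follows X (set_decode t) c x y" using t(1) by (simp add: derivation_def)
    moreover have "x \<in> X' \<longleftrightarrow> x \<in> X" using that fact_bounds[OF *] by blast
    ultimately show "follows X' (set_decode t) c x y" unfolding follows_def by simp
  qed
  then show ?thesis by blast
qed

text \<open>Every intermediate value occurs in a fact coded by \<open>t\<close>, hence is below
  \<open>t\<close>. With all quantifiers bounded, the condition becomes decidable.\<close>

lemma follows_bounded:
  "follows X (set_decode t) c x y \<longleftrightarrow>
     pfst c = 0 \<and> y = 0
   \<or> pfst c = 1 \<and> y = Suc x
   \<or> pfst c = 2 \<and> y = pfst x
   \<or> pfst c = 3 \<and> y = psnd x
   \<or> pfst c = 4 \<and> y = of_bool (x \<in> X)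
   \<or> pfst c = 5 \<and> \<langle>pfst (psnd c), \<langle>x, pfst y\<rangle>\<rangle> \<in> set_decode t \<and>
       \<langle>psnd (psnd c), \<langle>x, psnd y\<rangle>\<rangle> \<in> set_decode t
   \<or> pfst c = 6 \<and> (\<exists>u<t. \<langle>psnd (psnd c), \<langle>x, u\<rangle>\<rangle> \<in> set_decode t \<and>
       \<langle>pfst (psnd c), \<langle>u, y\<rangle>\<rangle> \<in> set_decode t)
   \<or> pfst c = 7 \<and> psnd x = 0 \<and> \<langle>pfst (psnd c), \<langle>pfst x, y\<rangle>\<rangle> \<in> set_decode t
   \<or> pfst c = 7 \<and> (\<exists>n<psnd x. \<exists>u<t. psnd x = Suc n \<and>
       \<langle>c, \<langle>\<langle>pfst x, n\<rangle>, u\<rangle>\<rangle> \<in> set_decode t \<and>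
       \<langle>psnd (psnd c), \<langle>\<langle>pfst x, \<langle>n, u\<rangle>\<rangle>, y\<rangle>\<rangle> \<in> set_decode t)
   \<or> pfst c = 8 \<and> \<langle>psnd c, \<langle>\<langle>x, y\<rangle>, 0\<rangle>\<rangle> \<in> set_decode t \<and>
       (\<forall>m<y. \<exists>k<t. \<langle>psnd c, \<langle>\<langle>x, m\<rangle>, Suc k\<rangle>\<rangle> \<in> set_decode t)"
proof -
  have 1: "(\<exists>u. \<langle>a, \<langle>x, u\<rangle>\<rangle> \<in> set_decode t \<and> Q u) \<longleftrightarrow>
      (\<exists>u<t. \<langle>a, \<langle>x, u\<rangle>\<rangle> \<in> set_decode t \<and> Q u)" for a x Q
    using fact_bounds by blast
  have 2: "(\<exists>k. \<langle>a, \<langle>x, Suc k\<rangle>\<rangle> \<in> set_decode t) \<longleftrightarrow>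
      (\<exists>k<t. \<langle>a, \<langle>x, Suc k\<rangle>\<rangle> \<in> set_decode t)" for a x
    using fact_bounds Suc_lessD by blast
  have 3: "(\<exists>n u. psnd x = Suc n \<and> \<langle>a, \<langle>f n, u\<rangle>\<rangle> \<in> set_decode t \<and> Q n u) \<longleftrightarrow>
      (\<exists>n<psnd x. \<exists>u<t. psnd x = Suc n \<and> \<langle>a, \<langle>f n, u\<rangle>\<rangle> \<in> set_decode t \<and> Q n u)" for a f Q
    using fact_bounds by (metis lessI)
  show ?thesis unfolding follows_def 1 2 3 ..
qed

text \<open>The oracle is a uniformly decidable family rather than one set, because later formulas
  quantify over finite oracles.\<close>

lemma is_Sigma_universal:
  assumes X: "decidable_in A (\<lambda>z. psnd z \<in> X (pfst z))"
    and f: "computable_in A w" "computable_in A c" "computable_in A x" "computable_in A y"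
  shows "is_Sigma (Suc 0) A (\<lambda>z. universal (X (w z)) (c z) (x z) (y z))"
proof -
  have "derivation X (set_decode t) \<longleftrightarrow>
      (\<forall>c<t. \<forall>x<t. \<forall>y<t. \<langle>c, \<langle>x, y\<rangle>\<rangle> \<in> set_decode t \<longrightarrow> follows X (set_decode t) c x y)" for X t
    unfolding derivation_def by (metis fact_bounds)
  moreover have "decidable_in A (\<lambda>z. \<forall>c<psnd z. \<forall>x<psnd z. \<forall>y<psnd z.
      \<langle>c, \<langle>x, y\<rangle>\<rangle> \<in> set_decode (psnd z) \<longrightarrow> follows (X (w (pfst z))) (set_decode (psnd z)) c x y)"
    unfolding follows_bounded
    by (intro computability_intros decidable_comp2[OF X] computable_comp[OF f(1)])
  ultimately have "decidable_in A (\<lambda>z. derivation (X (w (pfst z))) (set_decode (psnd z)))"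
    by simp
  then have "decidable_in A (\<lambda>z. derivation (X (w (pfst z))) (set_decode (psnd z)) \<and>
      \<langle>c (pfst z), \<langle>x (pfst z), y (pfst z)\<rangle>\<rangle> \<in> set_decode (psnd z))"
    by (intro computability_intros computable_comp[OF f(2)] computable_comp[OF f(3)]
        computable_comp[OF f(4)])
  then show ?thesis
    unfolding universal_def by (intro is_Sigma_ex is_Sigma_if_decidable)
qed

text \<open>Since \<open>universal\<close> does not exclude numbers that are no codes, being a code
  has to be expressed separately. As for derivations, a finite set closed under passing to the codes
  of subprograms serves as a certificate.\<close>

lemma is_Sigma_range_prog_code: "is_Sigma (Suc 0) A (\<lambda>c. c \<in> range prog_code)"
proof -
  define wf_code where "wf_code T c \<longleftrightarrow> pfst c < 5 \<and> psnd c = 0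
     \<or> 5 \<le> pfst c \<and> pfst c \<le> 7 \<and> pfst (psnd c) \<in> T \<and> psnd (psnd c) \<in> T
     \<or> pfst c = 8 \<and> psnd c \<in> T" for T :: "nat set" and c
  have sound: "c \<in> range prog_code" if T: "\<forall>c\<in>T. wf_code T c" and "c \<in> T" for T c
    using that(2)
  proof (induction c rule: less_induct)
    case (less c)
    obtain k b where c: "c = \<langle>k, b\<rangle>" and b: "b = \<langle>pfst b, psnd b\<rangle>"
      by (metis pair_pfst_psnd)
    have le: "pfst b \<le> b" "psnd b \<le> b"
      using le_prod_encode_1[of "pfst b" "psnd b"] le_prod_encode_2[of "psnd b" "pfst b"] by simp_all
    \<comment> \<open>This makes the induction on \<open>c\<close> descend. Tag \<open>0\<close> can
      violate it, but belongs to \<open>Zero\<close>, which has no subprograms.\<close>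
    have lt: "b < c" if "0 < k"
    proof -
      have "k + b \<le> triangle (k + b) + k"
        by (cases "k + b") auto
      with that show ?thesis by (simp add: c prod_encode_def)
    qed
    have "wf_code T c" using T less.prems by blast
    then consider "k < 5" "b = 0" | "5 \<le> k" "k \<le> 7" "pfst b \<in> T" "psnd b \<in> T" | "k = 8" "b \<in> T"
      by (auto simp: wf_code_def c)
    then show ?case
    proof cases
      case 1
      then have "k = 0 \<or> k = 1 \<or> k = 2 \<or> k = 3 \<or> k = 4" by auto
      then have "c \<in> {prog_code Zero, prog_code Succ, prog_code Proj1, prog_code Proj2,
          prog_code Query}"
        using 1(2) by (auto simp: c)
      then show ?thesis by blast
    next
      case 2
      then obtain p q where "pfst b = prog_code p" "psnd b = prog_code q"
        using less.IH lt le by (metis imageE less_le_trans not_numeral_le_zero gr0I le_less_trans)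
      with b have "b = \<langle>prog_code p, prog_code q\<rangle>" by simp
      moreover have "k = 5 \<or> k = 6 \<or> k = 7" using 2(1,2) by auto
      ultimately have "c \<in> {prog_code (Tuple p q), prog_code (Comp p q), prog_code (PRec p q)}"
        by (auto simp: c)
      then show ?thesis by blast
    next
      case 3
      then obtain p where "b = prog_code p" using less.IH lt by auto
      with 3 have "c = prog_code (Mu p)" by (simp add: c)
      then show ?thesis by blast
    qed
  qed
  have mono: "wf_code T c \<Longrightarrow> T \<subseteq> T' \<Longrightarrow> wf_code T' c" for T T' c
    by (auto simp: wf_code_def)
  have axiom_code: "\<exists>T. finite T \<and> (\<forall>c\<in>T. wf_code T c) \<and> c \<in> T" if "wf_code {} c" for c
    using mono[OF that, of "{c}"] by (intro exI[of _ "{c}"]) simp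
  have complete: "\<exists>T. finite T \<and> (\<forall>c\<in>T. wf_code T c) \<and> prog_code p \<in> T" for p
  proof (induction p)
    case (Mu p)
    then obtain T where T: "finite T" "\<forall>c\<in>T. wf_code T c" "prog_code p \<in> T" by blast
    then have "wf_code T (prog_code (Mu p))" by (simp add: wf_code_def)
    with T show ?case
      by (intro exI[of _ "insert (prog_code (Mu p)) T"]) (auto intro: mono)
  next
    case (Tuple p q)
    then obtain T T' where T: "finite T" "\<forall>c\<in>T. wf_code T c" "prog_code p \<in> T"
        "finite T'" "\<forall>c\<in>T'. wf_code T' c" "prog_code q \<in> T'" by blast
    then have "wf_code (T \<union> T') (prog_code (Tuple p q))" by (simp add: wf_code_def)
    with T show ?case
      by (intro exI[of _ "insert (prog_code (Tuple p q)) (T \<union> T')"]) (auto intro: mono)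
  next
    case (Comp p q)
    then obtain T T' where T: "finite T" "\<forall>c\<in>T. wf_code T c" "prog_code p \<in> T"
        "finite T'" "\<forall>c\<in>T'. wf_code T' c" "prog_code q \<in> T'" by blast
    then have "wf_code (T \<union> T') (prog_code (Comp p q))" by (simp add: wf_code_def)
    with T show ?case
      by (intro exI[of _ "insert (prog_code (Comp p q)) (T \<union> T')"]) (auto intro: mono)
  next
    case (PRec p q)
    then obtain T T' where T: "finite T" "\<forall>c\<in>T. wf_code T c" "prog_code p \<in> T"
        "finite T'" "\<forall>c\<in>T'. wf_code T' c" "prog_code q \<in> T'" by blast
    then have "wf_code (T \<union> T') (prog_code (PRec p q))" by (simp add: wf_code_def)
    with T show ?case
      by (intro exI[of _ "insert (prog_code (PRec p q)) (T \<union> T')"]) (auto intro: mono)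
  qed (rule axiom_code, simp add: wf_code_def)+
  have "(c \<in> range prog_code) \<longleftrightarrow>
      (\<exists>t. (\<forall>c<t. c \<in> set_decode t \<longrightarrow> wf_code (set_decode t) c) \<and> c \<in> set_decode t)" for c
  proof
    assume "c \<in> range prog_code"
    then obtain T where "finite T" "\<forall>c\<in>T. wf_code T c" "c \<in> T" using complete by blast
    then show "\<exists>t. (\<forall>c<t. c \<in> set_decode t \<longrightarrow> wf_code (set_decode t) c) \<and> c \<in> set_decode t"
      by (intro exI[of _ "set_encode T"]) simp
  next
    assume "\<exists>t. (\<forall>c<t. c \<in> set_decode t \<longrightarrow> wf_code (set_decode t) c) \<and> c \<in> set_decode t"
    then obtain t where "\<forall>c<t. c \<in> set_decode t \<longrightarrow> wf_code (set_decode t) c" "c \<in> set_decode t"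
      by blast
    then show "c \<in> range prog_code"
      using less_if_in_set_decode by (intro sound[of "set_decode t"]) simp_all
  qed
  moreover have "decidable_in A (\<lambda>z. (\<forall>c<psnd z. c \<in> set_decode (psnd z) \<longrightarrow>
      wf_code (set_decode (psnd z)) c) \<and> pfst z \<in> set_decode (psnd z))"
    unfolding wf_code_def by (intro computability_intros)
  ultimately show ?thesis
    by (simp only:) (intro is_Sigma_ex is_Sigma_if_decidable)
qed

section \<open>Definable collections of conditions\<close>

lemma universal_computes:
  assumes "computes p A S"
  shows "universal A (prog_code p) x (Suc 0) \<longleftrightarrow> x \<in> S"
    and "universal A (prog_code p) x 0 \<longleftrightarrow> x \<notin> S"
proof -
  have "eval A p x (of_bool (x \<in> S))" using assms by (simp add: computes_def)
  then show "universal A (prog_code p) x (Suc 0) \<longleftrightarrow> x \<in> S"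
    "universal A (prog_code p) x 0 \<longleftrightarrow> x \<notin> S"
    by (auto dest: eval_deterministic split: if_splits)
qed

lemma decidable_turing_join:
  assumes "computable_in (A \<oplus>\<^sub>T B) f"
  shows "decidable_in (A \<oplus>\<^sub>T B) (\<lambda>x. f x \<in> A)" "decidable_in (A \<oplus>\<^sub>T B) (\<lambda>x. f x \<in> B)"
proof -
  have A: "x \<in> A \<longleftrightarrow> x + x \<in> A \<oplus>\<^sub>T B" and B: "x \<in> B \<longleftrightarrow> Suc (x + x) \<in> A \<oplus>\<^sub>T B" for x
  proof -
    have "x + x = 2 * y \<longleftrightarrow> x = y" "x + x \<noteq> Suc (2 * y)" "Suc (x + x) \<noteq> 2 * y" for y
      by presburger+
    then show "x \<in> A \<longleftrightarrow> x + x \<in> A \<oplus>\<^sub>T B" "x \<in> B \<longleftrightarrow> Suc (x + x) \<in> A \<oplus>\<^sub>T B"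
      by (simp_all add: turing_join_def image_iff)
  qed
  show "decidable_in (A \<oplus>\<^sub>T B) (\<lambda>x. f x \<in> A)"
    unfolding A by (intro decidable_oracle computability_intros assms)
  show "decidable_in (A \<oplus>\<^sub>T B) (\<lambda>x. f x \<in> B)"
    unfolding B by (intro decidable_oracle computability_intros assms)
qed

lemma is_Sigma_universal_join:
  assumes "computable_in (A \<oplus>\<^sub>T B) c" "computable_in (A \<oplus>\<^sub>T B) x" "computable_in (A \<oplus>\<^sub>T B) y"
  shows "is_Sigma (Suc 0) (A \<oplus>\<^sub>T B) (\<lambda>z. universal A (c z) (x z) (y z))"
    and "is_Sigma (Suc 0) (A \<oplus>\<^sub>T B) (\<lambda>z. universal B (c z) (x z) (y z))"
  by (rule is_Sigma_universal[where X = "\<lambda>_. A", OF _ computable_const[of _ 0] assms],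
      intro decidable_turing_join computability_intros)
    (rule is_Sigma_universal[where X = "\<lambda>_. B", OF _ computable_const[of _ 0] assms],
      intro decidable_turing_join computability_intros)

section \<open>Indices of conditions and their complexity\<close>

text \<open>No quantifier over sets appears: equal answers of both programs at every
  \<open>x\<close> already determine a common reservoir. The remaining clauses express its
  infinitude and its position above the stem.\<close>

definition cond_index :: "nat set \<Rightarrow> nat set \<Rightarrow> nat \<Rightarrow> nat \<Rightarrow> nat \<Rightarrow> bool" where
  "cond_index A0 A1 d i j \<longleftrightarrow> i \<in> range prog_code \<and> j \<in> range prog_code
   \<and> (\<forall>x. universal A0 i x 0 \<and> universal A1 j x 0
        \<or> universal A0 i x (Suc 0) \<and> universal A1 j x (Suc 0))
   \<and> (\<forall>n. \<exists>y. n < y \<and> universal A0 i y (Suc 0))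
   \<and> (\<forall>a y. a \<in> set_decode d \<and> universal A0 i y (Suc 0) \<longrightarrow> a < y)"

lemma cond_index_prog_code:
  "cond_index A0 A1 d (prog_code p) (prog_code q) \<longleftrightarrow>
     (\<exists>S. computes p A0 S \<and> computes q A1 S \<and> mathias_condition (set_decode d, S))"
proof
  assume idx: "cond_index A0 A1 d (prog_code p) (prog_code q)"
  define S where "S = {x. eval A0 p x (Suc 0)}"
  have "eval A0 p x 0 \<and> eval A1 q x 0 \<or> eval A0 p x (Suc 0) \<and> eval A1 q x (Suc 0)" for x
    using idx by (auto simp: cond_index_def)
  then have p: "computes p A0 S" and "computes q A1 S"
    unfolding computes_def S_def
    by (auto dest: eval_deterministic split: if_splits)
  moreover have "infinite S"
    using idx by (auto simp: cond_index_def S_def infinite_nat_iff_unbounded)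
  moreover have "\<forall>a\<in>set_decode d. \<forall>s\<in>S. a < s"
    using idx by (auto simp: cond_index_def S_def)
  ultimately show "\<exists>S. computes p A0 S \<and> computes q A1 S \<and> mathias_condition (set_decode d, S)"
    by (auto simp: mathias_condition_def)
next
  assume "\<exists>S. computes p A0 S \<and> computes q A1 S \<and> mathias_condition (set_decode d, S)"
  then obtain S where S: "computes p A0 S" "computes q A1 S" "mathias_condition (set_decode d, S)"
    by blast
  show "cond_index A0 A1 d (prog_code p) (prog_code q)"
    unfolding cond_index_def universal_computes[OF S(1)] universal_computes[OF S(2)]
    using S(3) by (auto simp: mathias_condition_def infinite_nat_iff_unbounded)
qed

text \<open>Having a code is \<open>\<Sigma>\<^sub>1\<close>; all other clauses are universal
  quantifiers over \<open>\<Sigma>\<^sub>1\<close> formulas or over implications from such to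
  decidable ones.\<close>

lemma is_Pi_cond_index:
  "is_Pi 2 (A0 \<oplus>\<^sub>T A1) (\<lambda>z. cond_index A0 A1 (pfst z) (pfst (psnd z)) (psnd (psnd z)))"
  unfolding cond_index_def numeral_2_eq_2
  by (intro is_Pi_conj is_Pi_all is_Pi_imp;
      (intro is_Pi_Suc_if_is_Sigma is_Sigma_conj is_Sigma_disj is_Sigma_ex is_Sigma_universal_join
        is_Sigma_comp[OF is_Sigma_range_prog_code] computability_intros)?)
    (intro is_Sigma_lift is_Sigma_conj is_Sigma_universal_join is_Pi_if_decidable
      is_Sigma_if_decidable computability_intros)+

text \<open>Being an index is \<open>\<Pi>\<^sub>2\<close>, hence costs nothing at level 3, and only
  the property itself has to be analysed. \<open>Q\<close> is \<open>P\<close> in terms of indices: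
  the code of the stem and a program computing the reservoir from \<open>A0\<close>.\<close>

lemma Sigma0_definable_if_is_Sigma:
  assumes pair: "exact_pair I A0 A1"
    and Q: "is_Sigma 3 (A0 \<oplus>\<^sub>T A1) (\<lambda>z. Q (pfst z) (pfst (psnd z)))"
    and PQ: "\<And>d p S. computes p A0 S \<Longrightarrow> Q d (prog_code p) \<longleftrightarrow> P (set_decode d) S"
  shows "Sigma0_definable 3 I A0 A1 {(D, S) \<in> ideal_conditions I. P D S}"
proof -
  let ?C = "{(D, S) \<in> ideal_conditions I. P D S}"
  have iff: "z \<in> (\<Union>c\<in>?C. cond_indices A0 A1 c) \<longleftrightarrow>
      cond_index A0 A1 (pfst z) (pfst (psnd z)) (psnd (psnd z)) \<and> Q (pfst z) (pfst (psnd z))" for z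
  proof
    assume "z \<in> (\<Union>c\<in>?C. cond_indices A0 A1 c)"
    then obtain D S p q where *: "mathias_condition (D, S)" "P D S" "computes p A0 S"
        "computes q A1 S" "z = \<langle>set_encode D, \<langle>prog_code p, prog_code q\<rangle>\<rangle>"
      by (auto simp: ideal_conditions_def cond_indices_def)
    have "set_decode (set_encode D) = D" using *(1) by (simp add: mathias_condition_def)
    with * show "cond_index A0 A1 (pfst z) (pfst (psnd z)) (psnd (psnd z)) \<and> Q (pfst z) (pfst (psnd z))"
      by (auto simp: cond_index_prog_code PQ[OF *(3)])
  next
    assume *: "cond_index A0 A1 (pfst z) (pfst (psnd z)) (psnd (psnd z)) \<and> Q (pfst z) (pfst (psnd z))"
    then obtain p q where pq: "pfst (psnd z) = prog_code p" "psnd (psnd z) = prog_code q"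
      by (auto simp: cond_index_def)
    then obtain S where S: "computes p A0 S" "computes q A1 S" "mathias_condition (set_decode (pfst z), S)"
      using * by (auto simp: cond_index_prog_code)
    then have "S \<in> I" using pair by (auto simp: exact_pair_def turing_le_def)
    moreover have "P (set_decode (pfst z)) S" using * pq PQ[OF S(1)] by simp
    moreover have "z = \<langle>pfst z, \<langle>prog_code p, prog_code q\<rangle>\<rangle>"
      unfolding pq[symmetric] by simp
    ultimately show "z \<in> (\<Union>c\<in>?C. cond_indices A0 A1 c)"
      using S unfolding ideal_conditions_def cond_indices_def
      by (intro UN_I[of "(set_decode (pfst z), S)"]) auto
  qed
  have "is_Sigma 3 (A0 \<oplus>\<^sub>T A1) (\<lambda>z. cond_index A0 A1 (pfst z) (pfst (psnd z)) (psnd (psnd z)) \<and>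
      Q (pfst z) (pfst (psnd z)))"
    using is_Sigma_Suc_if_is_Pi[OF is_Pi_cond_index] Q
    by (intro is_Sigma_conj) (simp_all add: numeral_3_eq_3 numeral_2_eq_2)
  then have "(\<Union>c\<in>?C. cond_indices A0 A1 c) \<in> Sigma0 3 (A0 \<oplus>\<^sub>T A1)"
    unfolding is_Sigma_def iff[symmetric] Collect_mem_eq .
  then show ?thesis unfolding Sigma0_definable_def by blast
qed

lemma is_Sigma_universal_Un:
  assumes "computable_in A a" "computable_in A b" "computable_in A c" "computable_in A x" "computable_in A y"
  shows "is_Sigma (Suc 0) A (\<lambda>z. universal (set_decode (a z) \<union> set_decode (b z)) (c z) (x z) (y z))"
proof -
  have "decidable_in A (\<lambda>z. psnd z \<in> set_decode (a (pfst z)) \<union> set_decode (b (pfst z)))"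
    unfolding Un_iff
    by (intro computability_intros computable_comp[OF assms(1)] computable_comp[OF assms(2)])
  from is_Sigma_universal[where X = "\<lambda>z. set_decode (a z) \<union> set_decode (b z)", OF this computable_id assms(3-5)]
  show ?thesis .
qed

text \<open>If \<open>i\<close> is an index of a set, the formula expresses that
  \<open>set_decode f\<close> is not contained in it. Asking for the answer \<open>0\<close>, rather
  than for the absence of the answer \<open>1\<close>, keeps it
  \<open>\<Sigma>\<^sub>1\<close>.\<close>

lemma is_Sigma_not_subset:
  assumes "computable_in (A \<oplus>\<^sub>T B) f" "computable_in (A \<oplus>\<^sub>T B) i"
  shows "is_Sigma (Suc 0) (A \<oplus>\<^sub>T B) (\<lambda>z. \<exists>y. y \<in> set_decode (f z) \<and> universal A (i z) y 0)"
  by (intro is_Sigma_ex is_Sigma_conj is_Sigma_universal_join is_Sigma_if_decidable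
      computability_intros computable_comp[OF assms(1)] computable_comp[OF assms(2)])

lemma is_Sigma_universal_all:
  assumes "computable_in A e" "computable_in A a" "computable_in A b" "computable_in A c" "computable_in A v"
  shows "is_Sigma (Suc 0) A (\<lambda>z. \<forall>y<e z. y \<notin> set_decode (e z) \<or>
    universal (set_decode (a z) \<union> set_decode (b z)) (c z) y (v z))"
proof (rule is_Sigma_1_ball[OF is_Sigma_disj assms(1)])
  show "is_Sigma (Suc 0) A (\<lambda>z. psnd z \<notin> set_decode (e (pfst z)))"
    by (intro is_Sigma_if_decidable computability_intros computable_comp[OF assms(1)])
  show "is_Sigma (Suc 0) A (\<lambda>z. universal (set_decode (a (pfst z)) \<union> set_decode (b (pfst z)))
      (c (pfst z)) (psnd z) (v (pfst z)))"
    by (intro is_Sigma_universal_Un computability_intros computable_comp[OF assms(2)]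
        computable_comp[OF assms(3)] computable_comp[OF assms(4)] computable_comp[OF assms(5)])
qed

section \<open>Using genericity and extending conditions\<close>

text \<open>Turns genericity into a case distinction: either the generic set satisfies a condition
  with property \<open>P\<close>, or it satisfies one without extensions of that kind.\<close>

lemma generic_cases:
  assumes "exact_pair I A0 A1" "generic 3 I A0 A1 G"
    and "is_Sigma 3 (A0 \<oplus>\<^sub>T A1) (\<lambda>z. Q (pfst z) (pfst (psnd z)))"
    and "\<And>d p S. computes p A0 S \<Longrightarrow> Q d (prog_code p) \<longleftrightarrow> P (set_decode d) S"
  obtains (meets) D S where "(D, S) \<in> ideal_conditions I" "satisfies G (D, S)" "P D S"
  | (avoids) D S where "(D, S) \<in> ideal_conditions I" "satisfies G (D, S)"
      "\<And>D' S'. (D', S') \<in> ideal_conditions I \<Longrightarrow> extends (D', S') (D, S) \<Longrightarrow> \<not> P D' S'"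
proof -
  have "Sigma0_definable 3 I A0 A1 {(D, S) \<in> ideal_conditions I. P D S}"
    by (rule Sigma0_definable_if_is_Sigma[OF assms(1,3)]) (rule assms(4))
  then have "meets G {(D, S) \<in> ideal_conditions I. P D S} \<or> avoids I G {(D, S) \<in> ideal_conditions I. P D S}"
    using assms(2) unfolding generic_def by blast
  then show thesis
  proof
    assume "meets G {(D, S) \<in> ideal_conditions I. P D S}"
    then show thesis using meets by (auto simp: meets_def)
  next
    assume "avoids I G {(D, S) \<in> ideal_conditions I. P D S}"
    then obtain D S where "(D, S) \<in> ideal_conditions I" "satisfies G (D, S)"
        "\<not> (\<exists>c'\<in>{(D, S) \<in> ideal_conditions I. P D S}. extends c' (D, S))"
      unfolding avoids_def by auto
    then show thesis using avoids[of D S] by blast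
  qed
qed

lemma decidable_turing_le:
  assumes "X \<le>\<^sub>T A" "computable_in A f" shows "decidable_in A (\<lambda>x. f x \<in> X)"
  using assms by (auto simp: turing_le_iff_decidable intro: decidable_comp)

lemma exact_pair_downward_closed:
  assumes "exact_pair I A0 A1" "Y \<in> I" "X \<le>\<^sub>T Y"
  shows "X \<in> I"
  using assms turing_le_trans unfolding exact_pair_def by blast

text \<open>Elements of the reservoir may join the stem once the reservoir is cut above them.
  Cutting it further at \<open>m\<close> protects computations that query only below
  \<open>m\<close>, and removing finitely many elements stays within the ideal.\<close>

lemma extension_in_ideal_conditions:
  assumes pair: "exact_pair I A0 A1" and DS: "(D, S) \<in> ideal_conditions I"
    and F: "finite F" "F \<subseteq> S" and R: "infinite R" "R \<subseteq> S" "R \<in> I"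
  obtains R' where "(D \<union> F, R') \<in> ideal_conditions I" "extends (D \<union> F, R') (D, S)"
    "R' \<subseteq> R" "\<forall>s\<in>R'. m \<le> s"
proof -
  define b where "b = Max (insert m (Suc ` F))"
  define R' where "R' = {s \<in> R. b \<le> s}"
  have b: "m \<le> b" "\<forall>x\<in>F. x < b"
    using F(1) by (auto simp: b_def Suc_le_eq[symmetric] intro!: Max_ge)
  have S: "finite D" "\<forall>d\<in>D. \<forall>s\<in>S. d < s"
    using DS by (auto simp: ideal_conditions_def mathias_condition_def)
  have "R' \<le>\<^sub>T R" unfolding turing_le_iff_decidable R'_def mem_Collect_eq
    by (intro computability_intros decidable_oracle)
  with pair R(3) have "R' \<in> I" by (rule exact_pair_downward_closed)
  moreover have "R = R' \<union> (R \<inter> {..<b})" by (auto simp: R'_def)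
  then have "infinite R'" using R(1) by (metis finite_Int finite_UnI finite_lessThan)
  ultimately have "(D \<union> F, R') \<in> ideal_conditions I"
    using S F R(2) b by (fastforce simp: ideal_conditions_def mathias_condition_def R'_def)
  moreover have "extends (D \<union> F, R') (D, S)" using F R(2) by (auto simp: extends_def R'_def)
  ultimately show thesis using b(1) by (intro that) (auto simp: R'_def)
qed

lemma eval_use_finite:
  assumes "finite E" "\<forall>y\<in>E. eval X p y v"
  obtains m where "\<forall>X'. (\<forall>z<m. z \<in> X' \<longleftrightarrow> z \<in> X) \<longrightarrow> (\<forall>y\<in>E. eval X' p y v)"
proof -
  have "\<forall>y\<in>E. \<exists>m. \<forall>X'. (\<forall>z<m. z \<in> X' \<longleftrightarrow> z \<in> X) \<longrightarrow> eval X' p y v"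
    using assms(2) eval_use by blast
  then obtain u where u: "\<And>y X'. y \<in> E \<Longrightarrow> \<forall>z<u y. z \<in> X' \<longleftrightarrow> z \<in> X \<Longrightarrow> eval X' p y v"
    by metis
  have "u y \<le> Max (u ` E)" if "y \<in> E" for y using assms(1) that by simp
  then show thesis by (intro that[of "Max (u ` E)"]) (meson u less_le_trans)
qed

text \<open>An infinite reservoir always offers an element beyond \<open>n\<close> to put into the
  stem, so stems with such an element cannot be avoided.\<close>

lemma generic_infinite:
  assumes "exact_pair I A0 A1" "generic 3 I A0 A1 G"
  shows "infinite G"
  unfolding infinite_nat_iff_unbounded_le
proof
  fix n
  show "\<exists>x\<ge>n. x \<in> G"
  proof (rule generic_cases[OF assms, of "\<lambda>d i. \<exists>x. n \<le> x \<and> x \<in> set_decode d"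
        "\<lambda>D S. \<exists>x. n \<le> x \<and> x \<in> D"])
    show "is_Sigma 3 (A0 \<oplus>\<^sub>T A1) (\<lambda>z. \<exists>x. n \<le> x \<and> x \<in> set_decode (pfst z))"
      unfolding numeral_3_eq_3 by (intro is_Sigma_ex is_Sigma_if_decidable computability_intros)
  next
    fix D S assume "satisfies G (D, S)" "\<exists>x. n \<le> x \<and> x \<in> D"
    then show ?thesis by (auto simp: satisfies_def)
  next
    fix D S assume DS: "(D, S) \<in> ideal_conditions I"
      and no: "\<And>D' S'. (D', S') \<in> ideal_conditions I \<Longrightarrow> extends (D', S') (D, S) \<Longrightarrow>
        \<not> (\<exists>x. n \<le> x \<and> x \<in> D')"
    obtain s where "s \<in> S" "n \<le> s"
      using DS by (auto simp: ideal_conditions_def mathias_condition_def infinite_nat_iff_unbounded_le)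
    have "infinite S" "S \<in> I"
      using DS by (auto simp: ideal_conditions_def mathias_condition_def)
    then obtain S' where "(D \<union> {s}, S') \<in> ideal_conditions I" "extends (D \<union> {s}, S') (D, S)"
      using \<open>s \<in> S\<close> extension_in_ideal_conditions[OF assms(1) DS, of "{s}" S 0] by auto
    with no \<open>n \<le> s\<close> show ?thesis by blast
  qed auto
qed

section \<open>Computing an infinite set along an enumerable family of finite sets\<close>

text \<open>Since \<open>T\<close> has no dead ends, searching for an extension and its witness
  never gets stuck. Each new element exceeds the code of the set built so far, so the elements
  increase and the union is computable, not merely enumerable.\<close>

lemma infinite_set_with_finite_subsets:
  assumes T: "is_Sigma (Suc 0) B T" "T 0"
    and step: "\<And>l. T l \<Longrightarrow> \<exists>r>l. T (l + 2 ^ r)"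
  obtains R where "infinite R" "R \<le>\<^sub>T B"
    "\<forall>F\<subseteq>R. finite F \<longrightarrow> (\<exists>l. T l \<and> F \<subseteq> set_decode l)"
proof -
  obtain Q where Q: "decidable_in B Q" "\<And>x. T x \<longleftrightarrow> (\<exists>y. Q \<langle>x, y\<rangle>)"
    using T(1) by (auto simp: is_Sigma_1_iff)
  obtain w0 where w0: "Q \<langle>0, w0\<rangle>" using T(2) Q(2) by blast
  text \<open>The states are pairs of a code and a witness for \<open>T\<close>; the first disjunct makes the
    search for the next state total.\<close>
  define P where "P s k \<longleftrightarrow> \<not> Q s \<or> pfst s < pfst k \<and> Q \<langle>pfst s + 2 ^ pfst k, psnd k\<rangle>" for s k
  have "decidable_in B (\<lambda>z. P (pfst z) (psnd z))"
    unfolding P_def by (intro computability_intros decidable_comp[OF Q(1)])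
  moreover have ex: "\<exists>k. P s k" for s
  proof (cases "Q s")
    case True
    then have "T (pfst s)" by (auto simp: Q(2) intro!: exI[of _ "psnd s"])
    then obtain r y where "r > pfst s" "Q \<langle>pfst s + 2 ^ r, y\<rangle>" using step Q(2) by blast
    then show ?thesis by (intro exI[of _ "\<langle>r, y\<rangle>"]) (simp add: P_def)
  qed (simp add: P_def)
  ultimately have least: "computable_in B (\<lambda>s. LEAST k. P s k)" by (rule computable_Least)
  define r where "r s = pfst (LEAST k. P s k)" for s
  define nxt where "nxt s = \<langle>pfst s + 2 ^ r s, psnd (LEAST k. P s k)\<rangle>" for s
  define st where "st n = (nxt ^^ n) \<langle>0, w0\<rangle>" for n
  define L where "L n = set_decode (pfst (st n))" for n
  have "computable_in B nxt"
    unfolding nxt_def r_def by (intro computability_intros least)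
  then have "computable_in B (\<lambda>z. nxt (psnd (psnd z)))"
    by (rule computable_comp) (intro computability_intros)
  then have "computable_in B (\<lambda>z. st (psnd z))"
    by (rule computable_prec[where g = "\<lambda>a n u. nxt u" and h = "\<lambda>_. st", OF computable_const[of _ "\<langle>0, w0\<rangle>"]])
      (simp_all add: st_def)
  from computable_comp[OF this computable_pair[OF computable_const[of B 0] computable_id]]
  have st: "computable_in B st" by simp
  have Qst: "Q (st n)" for n
  proof (induction n)
    case (Suc n)
    then have "Q \<langle>pfst (st n) + 2 ^ r (st n), psnd (LEAST k. P (st n) k)\<rangle>"
      using LeastI_ex[OF ex[of "st n"]] by (auto simp: P_def r_def)
    then show ?case by (simp add: st_def nxt_def)
  qed (simp add: st_def w0)
  have r: "pfst (st n) < r (st n)" for n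
    using LeastI_ex[OF ex[of "st n"]] Qst by (auto simp: P_def r_def)
  have pfst_st: "pfst (st (Suc n)) = 2 ^ r (st n) + pfst (st n)" for n
    by (simp add: st_def nxt_def)
  have ge: "n \<le> pfst (st n)" for n
  proof (induction n)
    case (Suc n)
    then show ?case unfolding pfst_st using one_le_power[of "2::nat" "r (st n)"] by linarith
  qed simp
  have LS: "L (Suc n) = insert (r (st n)) (L n)" for n
    unfolding L_def pfst_st using r[of n] less_if_in_set_decode
    by (intro set_decode_plus_power_2) (meson less_asym)
  have mono: "m \<le> n \<Longrightarrow> L m \<subseteq> L n" for m n
    by (rule lift_Suc_mono_le[of L]) (auto simp: LS)
  \<comment> \<open>The element added at stage \<open>n\<close> is larger than \<open>n\<close>,
    because the code has grown at least to \<open>n\<close>; so stage \<open>Suc y\<close> decides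
    whether \<open>y\<close> ever enters.\<close>
  have L: "y \<in> L n \<Longrightarrow> y \<in> L (Suc y)" for y n
  proof (induction n)
    case (Suc n)
    show ?case
    proof (cases "y \<in> L n")
      case False
      then have "y = r (st n)" using Suc.prems by (simp add: LS)
      then have "Suc n \<le> Suc y" using r[of n] ge[of n] by linarith
      then show ?thesis using Suc.prems mono by blast
    qed (use Suc.IH in blast)
  qed (simp add: L_def st_def)
  define R where "R = {y. y \<in> L (Suc y)}"
  have "infinite R"
    unfolding infinite_nat_iff_unbounded_le
  proof
    fix n
    have "r (st n) \<in> R" using L[of "r (st n)" "Suc n"] by (simp add: R_def LS)
    moreover have "n \<le> r (st n)" using r[of n] ge[of n] by linarith
    ultimately show "\<exists>x\<ge>n. x \<in> R" by blast
  qed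
  moreover have "R \<le>\<^sub>T B"
    unfolding turing_le_iff_decidable R_def L_def mem_Collect_eq
    by (intro computability_intros computable_comp[OF st])
  moreover have "\<forall>F\<subseteq>R. finite F \<longrightarrow> (\<exists>l. T l \<and> F \<subseteq> set_decode l)"
  proof (intro allI impI)
    fix F assume "F \<subseteq> R" "finite F"
    have "T (pfst (st (Suc (Max F))))"
      unfolding Q(2) using Qst[of "Suc (Max F)"] by (metis pair_pfst_psnd)
    moreover have "y \<in> L (Suc (Max F))" if "y \<in> F" for y
      using that \<open>F \<subseteq> R\<close> mono[of "Suc y" "Suc (Max F)"] Max_ge[OF \<open>finite F\<close> that]
      by (auto simp: R_def)
    ultimately show "\<exists>l. T l \<and> F \<subseteq> set_decode l" by (auto simp: L_def)
  qed
  ultimately show thesis by (rule that)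
qed

section \<open>Programs recovering a generic set from subsets\<close>

text \<open>Cutting \<open>X\<close> off at \<open>m\<close> gives a finite approximation; with
  \<open>m\<close> a use bound, it reproduces a given computation from \<open>X\<close>.\<close>

lemma satisfies_approximation:
  assumes "satisfies X (D, S)"
  obtains f where "set_decode f \<subseteq> S" "\<And>z. z < m \<Longrightarrow> z \<in> D \<union> set_decode f \<longleftrightarrow> z \<in> X"
proof (rule that[of "set_encode (X \<inter> S \<inter> {..<m})"])
  show "set_decode (set_encode (X \<inter> S \<inter> {..<m})) \<subseteq> S" by auto
  show "z \<in> D \<union> set_decode (set_encode (X \<inter> S \<inter> {..<m})) \<longleftrightarrow> z \<in> X" if "z < m" for z
    using assms that by (auto simp: satisfies_def)
qed

lemma satisfies_eval:
  assumes "satisfies X (D, S)" "eval X p x v"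
  obtains f where "set_decode f \<subseteq> S" "eval (D \<union> set_decode f) p x v"
proof -
  obtain m where "\<And>X'. \<forall>z<m. z \<in> X' \<longleftrightarrow> z \<in> X \<Longrightarrow> eval X' p x v"
    using eval_use[OF assms(2)] by blast
  moreover obtain f where "set_decode f \<subseteq> S" "\<And>z. z < m \<Longrightarrow> z \<in> D \<union> set_decode f \<longleftrightarrow> z \<in> X"
    using satisfies_approximation[OF assms(1)] by blast
  ultimately show thesis using that by blast
qed

text \<open>The true oracle \<open>H\<close> refutes both ways in which a condition could spoil
  \<open>p\<close>, so genericity yields a condition below which neither can be arranged.\<close>

lemma generic_computes:
  assumes pair: "exact_pair I A0 A1" and gen: "generic 3 I A0 A1 H"
    and p: "computes p H G" and G: "G \<le>\<^sub>T A0 \<oplus>\<^sub>T A1"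
  obtains D S where "(D, S) \<in> ideal_conditions I" "satisfies H (D, S)"
    "\<And>E x v. finite E \<Longrightarrow> E \<subseteq> S \<Longrightarrow> eval (D \<union> E) p x v \<Longrightarrow> v = of_bool (x \<in> G)"
    "\<And>R x. R \<subseteq> S \<Longrightarrow> infinite R \<Longrightarrow> R \<in> I \<Longrightarrow> \<exists>E v. finite E \<and> E \<subseteq> R \<and> eval (D \<union> E) p x v"
proof -
  let ?A = "A0 \<oplus>\<^sub>T A1"
  \<comment> \<open>The bad conditions: at some \<open>x\<close>, either all finite approximations
    give one and the same wrong answer, or none gives any. Both alternatives are an existential
    quantifier over a \<open>\<Pi>\<^sub>2\<close> formula.\<close>
  let ?P = "\<lambda>D S. (\<exists>x v. v \<noteq> of_bool (x \<in> G) \<and> (\<forall>f. \<not> set_decode f \<subseteq> S \<or> eval (D \<union> set_decode f) p x v))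
    \<or> (\<exists>x. \<forall>f v. \<not> set_decode f \<subseteq> S \<or> \<not> eval (D \<union> set_decode f) p x v)"
  let ?Q = "\<lambda>d i. (\<exists>x v. v \<noteq> of_bool (x \<in> G) \<and> (\<forall>f. (\<exists>y. y \<in> set_decode f \<and> universal A0 i y 0)
        \<or> universal (set_decode d \<union> set_decode f) (prog_code p) x v))
    \<or> (\<exists>x. \<forall>f v. (\<exists>y. y \<in> set_decode f \<and> universal A0 i y 0)
        \<or> \<not> universal (set_decode d \<union> set_decode f) (prog_code p) x v)"
  show thesis
  proof (rule generic_cases[OF pair gen, of ?Q ?P])
    show "is_Sigma 3 ?A (\<lambda>z. ?Q (pfst z) (pfst (psnd z)))"
      unfolding numeral_3_eq_3
      by (intro is_Sigma_disj is_Sigma_ex is_Sigma_conj is_Sigma_if_decidable[OF decidable_not]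
          decidable_eq computability_intros decidable_turing_le[OF G];
          intro is_Sigma_Suc_if_is_Pi is_Pi_all is_Pi_disj;
          (intro is_Pi_lift[OF is_Pi_not] is_Sigma_universal_Un computability_intros)?;
          intro is_Pi_Suc_if_is_Sigma is_Sigma_disj is_Sigma_ex is_Sigma_conj is_Sigma_universal_join
            is_Sigma_universal_Un is_Sigma_if_decidable computability_intros)
  next
    fix d r S assume "computes r A0 S"
    from universal_computes(2)[OF this]
    have "(\<exists>y. y \<in> set_decode f \<and> universal A0 (prog_code r) y 0) \<longleftrightarrow> \<not> set_decode f \<subseteq> S" for f
      by blast
    then show "?Q d (prog_code r) \<longleftrightarrow> ?P (set_decode d) S" by simp
  next
    fix D S assume sat: "satisfies H (D, S)" and P: "?P D S"
    have "\<exists>f. set_decode f \<subseteq> S \<and> eval (D \<union> set_decode f) p x (of_bool (x \<in> G))" for x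
      using satisfies_eval[OF sat] p unfolding computes_def by metis
    with P show thesis by (metis eval_deterministic)
  next
    fix D S assume DS: "(D, S) \<in> ideal_conditions I" and sat: "satisfies H (D, S)"
      and no: "\<And>D' S'. (D', S') \<in> ideal_conditions I \<Longrightarrow> extends (D', S') (D, S) \<Longrightarrow> \<not> ?P D' S'"
    have S: "infinite S" "S \<in> I" "\<And>R. infinite R \<Longrightarrow> R \<subseteq> S \<Longrightarrow> mathias_condition (D, R)"
      using DS by (auto simp: ideal_conditions_def mathias_condition_def)
    show thesis
    proof (rule that[OF DS sat])
      fix E x v assume E: "finite E" "E \<subseteq> S" and ev: "eval (D \<union> E) p x v"
      \<comment> \<open>With the reservoir moved beyond the use of this computation, a wrong
        \<open>v\<close> would persist for all further approximations and make the extension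
        bad.\<close>
      obtain m where m: "\<And>X'. \<forall>z<m. z \<in> X' \<longleftrightarrow> z \<in> D \<union> E \<Longrightarrow> eval X' p x v"
        using eval_use[OF ev] by blast
      obtain R where R: "(D \<union> E, R) \<in> ideal_conditions I" "extends (D \<union> E, R) (D, S)"
          "\<forall>s\<in>R. m \<le> s"
        using extension_in_ideal_conditions[OF pair DS E S(1) order_refl S(2)] by metis
      have "eval (D \<union> E \<union> set_decode f) p x v" if "set_decode f \<subseteq> R" for f
        using that R(3) by (intro m) fastforce
      with no[OF R(1,2)] show "v = of_bool (x \<in> G)" by blast
    next
      fix R x assume R: "R \<subseteq> S" "infinite R" "R \<in> I"
      then have "(D, R) \<in> ideal_conditions I" using S(3) by (simp add: ideal_conditions_def)
      moreover have "extends (D, R) (D, S)" using R by (simp add: extends_def)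
      ultimately have "\<not> ?P D R" by (rule no)
      then obtain f v where "set_decode f \<subseteq> R" "eval (D \<union> set_decode f) p x v" by blast
      then show "\<exists>E v. finite E \<and> E \<subseteq> R \<and> eval (D \<union> E) p x v"
        by (intro exI[of _ "set_decode f"] exI[of _ v]) simp
    qed
  qed
qed

text \<open>\<open>G\<close> is not assumed computable in \<open>A0 \<oplus>\<^sub>T A1\<close>, so
  a definable collection cannot simply refer to \<open>G\<close> or \<open>S\<close>. Approximations
  \<open>D' \<union> f\<close> stand for \<open>G\<close>, and acceptance by \<open>q\<close> over
  them stands for membership in \<open>S\<close>.\<close>

lemma generic_not_computed_from_subsets:
  assumes pair: "exact_pair I A0 A1" and gen: "generic 3 I A0 A1 G"
    and q: "computes q G S" and "S \<subseteq> G" and "finite D"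
    and correct: "\<And>E x v. finite E \<Longrightarrow> E \<subseteq> S \<Longrightarrow> eval (D \<union> E) p x v \<Longrightarrow> v = of_bool (x \<in> G)"
    and total: "\<And>F x. finite F \<Longrightarrow> \<exists>E v. finite E \<and> E \<subseteq> S - F \<and> eval (D \<union> E) p x v"
  shows False
proof -
  obtain d0 where D: "D = set_decode d0"
    using \<open>finite D\<close> by (metis set_encode_inverse)
  let ?A = "A0 \<oplus>\<^sub>T A1"
  \<comment> \<open>Bad conditions again: either one fixed finite set \<open>e\<close>, accepted
    over every approximation, makes \<open>p\<close> answer wrongly about that approximation at
    \<open>x\<close>; or no accepted \<open>e\<close> within the reservoir makes \<open>p\<close>
    answer \<open>x\<close> at all.\<close>
  let ?P = "\<lambda>D' S'.
      (\<exists>e x v. \<forall>f. \<not> set_decode f \<subseteq> S' \<or>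
        (\<forall>y<e. y \<in> set_decode e \<longrightarrow> eval (D' \<union> set_decode f) q y (Suc 0)) \<and>
        eval (D \<union> set_decode e) p x v \<and> v \<noteq> of_bool (x \<in> D' \<union> set_decode f))
    \<or> (\<exists>x. \<forall>f e v. \<not> set_decode f \<subseteq> S' \<or> \<not> set_decode e \<subseteq> S' \<or>
        \<not> (\<forall>y<e. y \<in> set_decode e \<longrightarrow> eval (D' \<union> set_decode f) q y (Suc 0)) \<or>
        \<not> eval (D \<union> set_decode e) p x v)"
  let ?Q = "\<lambda>d i.
      (\<exists>e x v. \<forall>f. (\<exists>y. y \<in> set_decode f \<and> universal A0 i y 0) \<or>
        (\<forall>y<e. y \<notin> set_decode e \<or>
          universal (set_decode d \<union> set_decode f) (prog_code q) y (Suc 0)) \<and>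
        universal (set_decode d0 \<union> set_decode e) (prog_code p) x v \<and>
        v \<noteq> of_bool (x \<in> set_decode d \<or> x \<in> set_decode f))
    \<or> (\<exists>x. \<forall>f e v. (\<exists>y. y \<in> set_decode f \<and> universal A0 i y 0) \<or>
        (\<exists>y. y \<in> set_decode e \<and> universal A0 i y 0) \<or>
        \<not> (\<forall>y<e. y \<notin> set_decode e \<or>
          universal (set_decode d \<union> set_decode f) (prog_code q) y (Suc 0)) \<or>
        \<not> universal (set_decode d0 \<union> set_decode e) (prog_code p) x v)"
  have sub: "(\<forall>y<e. y \<in> set_decode e \<longrightarrow> eval X q y (Suc 0)) \<longleftrightarrow>
      (\<forall>y\<in>set_decode e. eval X q y (Suc 0))" for e X
    using less_if_in_set_decode by blast
  show False
  proof (rule generic_cases[OF pair gen, of ?Q ?P])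
    show "is_Sigma 3 ?A (\<lambda>z. ?Q (pfst z) (pfst (psnd z)))"
      unfolding numeral_3_eq_3
      by (intro is_Sigma_disj is_Sigma_ex; rule is_Sigma_Suc_if_is_Pi; intro is_Pi_all is_Pi_disj)
        (rule is_Pi_lift[OF is_Pi_not]
          | intro is_Pi_Suc_if_is_Sigma is_Sigma_conj is_Sigma_not_subset is_Sigma_universal_all
            is_Sigma_universal_Un is_Sigma_if_decidable[OF decidable_not[OF decidable_eq]]
            computability_intros)+
  next
    fix d r S' assume "computes r A0 S'"
    from universal_computes(2)[OF this]
    have "(\<exists>y. y \<in> set_decode f \<and> universal A0 (prog_code r) y 0) \<longleftrightarrow> \<not> set_decode f \<subseteq> S'" for f
      by blast
    then show "?Q d (prog_code r) \<longleftrightarrow> ?P (set_decode d) S'"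
      by (simp only: D universal_prog_code Un_iff imp_conv_disj)
  next
    fix D' S' assume "(D', S') \<in> ideal_conditions I" and sat: "satisfies G (D', S')"
      and P: "?P D' S'"
    then have "finite D'" by (simp add: ideal_conditions_def mathias_condition_def)
    from P show False
    proof (elim disjE exE)
      fix e x v
      assume *: "\<forall>f. \<not> set_decode f \<subseteq> S' \<or>
        (\<forall>y<e. y \<in> set_decode e \<longrightarrow> eval (D' \<union> set_decode f) q y (Suc 0)) \<and>
        eval (D \<union> set_decode e) p x v \<and> v \<noteq> of_bool (x \<in> D' \<union> set_decode f)"
      \<comment> \<open>Some approximation of \<open>G\<close> already yields the true answer of
        \<open>q\<close> at \<open>y\<close>; since \<open>e\<close> is accepted there too, that
        answer is \<open>1\<close>.\<close>
      have "y \<in> S" if "y \<in> set_decode e" for y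
      proof -
        have "eval G q y (of_bool (y \<in> S))" using q by (simp add: computes_def)
        then obtain f where "set_decode f \<subseteq> S'" "eval (D' \<union> set_decode f) q y (of_bool (y \<in> S))"
          using satisfies_eval[OF sat] by blast
        moreover from this(1) have "eval (D' \<union> set_decode f) q y (Suc 0)"
          using * that unfolding sub by blast
        ultimately have "of_bool (y \<in> S) = Suc 0" by (metis eval_deterministic)
        then show ?thesis by (cases "y \<in> S") simp_all
      qed
      then have "set_decode e \<subseteq> S" by blast
      \<comment> \<open>The bound \<open>Suc x\<close> makes the approximation agree with
        \<open>G\<close> at \<open>x\<close> itself.\<close>
      moreover obtain f where f: "set_decode f \<subseteq> S'"
          "\<And>z. z < Suc x \<Longrightarrow> z \<in> D' \<union> set_decode f \<longleftrightarrow> z \<in> G"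
        using satisfies_approximation[OF sat] by blast
      ultimately have "v = of_bool (x \<in> G)"
        using *[rule_format, of f] by (intro correct[of "set_decode e"]) auto
      moreover have "x \<in> D' \<union> set_decode f \<longleftrightarrow> x \<in> G" by (rule f(2)) simp
      ultimately show False using *[rule_format, of f] f(1) by simp
    next
      fix x
      assume *: "\<forall>f e v. \<not> set_decode f \<subseteq> S' \<or> \<not> set_decode e \<subseteq> S' \<or>
        \<not> (\<forall>y<e. y \<in> set_decode e \<longrightarrow> eval (D' \<union> set_decode f) q y (Suc 0)) \<or>
        \<not> eval (D \<union> set_decode e) p x v"
      \<comment> \<open>Discarding the stem \<open>D'\<close> forces \<open>E\<close> into
        \<open>S'\<close>, where the remaining elements of \<open>G\<close> lie.\<close>
      obtain E v where E: "finite E" "E \<subseteq> S - D'" "eval (D \<union> E) p x v"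
        using total[OF \<open>finite D'\<close>, of x] by blast
      have "E \<subseteq> S'" using E(2) \<open>S \<subseteq> G\<close> sat by (auto simp: satisfies_def)
      have "\<forall>y\<in>E. eval G q y (Suc 0)"
      proof
        fix y assume "y \<in> E"
        then have "y \<in> S" using E(2) by blast
        with q[unfolded computes_def, rule_format, of y] show "eval G q y (Suc 0)" by simp
      qed
      from E(1) this obtain m
        where m: "\<forall>X'. (\<forall>z<m. z \<in> X' \<longleftrightarrow> z \<in> G) \<longrightarrow> (\<forall>y\<in>E. eval X' q y (Suc 0))"
        by (rule eval_use_finite)
      obtain f where f: "set_decode f \<subseteq> S'" "\<And>z. z < m \<Longrightarrow> z \<in> D' \<union> set_decode f \<longleftrightarrow> z \<in> G"
        using satisfies_approximation[OF sat] by blast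
      have "\<forall>y\<in>E. eval (D' \<union> set_decode f) q y (Suc 0)" 
        by (rule m[THEN spec, THEN mp]) (use f(2) in blast)
      moreover have "set_decode (set_encode E) = E" using E(1) by simp
      ultimately show False
        using *[rule_format, of f "set_encode E" v] f(1) E(3) \<open>E \<subseteq> S'\<close> unfolding sub by metis
    qed
  next
    fix D1 S1 assume DS: "(D1, S1) \<in> ideal_conditions I" and sat: "satisfies G (D1, S1)"
      and no: "\<And>D' S'. (D', S') \<in> ideal_conditions I \<Longrightarrow> extends (D', S') (D1, S1) \<Longrightarrow> \<not> ?P D' S'"
    have S1: "finite D1" "infinite S1" "S1 \<in> I" "\<And>a s. a \<in> D1 \<Longrightarrow> s \<in> S1 \<Longrightarrow> a < s"
      using DS by (auto simp: ideal_conditions_def mathias_condition_def)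
    \<comment> \<open>A wrong answer would survive on a reservoir beyond both \<open>x\<close> and
      the uses of \<open>q\<close> on \<open>e\<close>: acceptance of \<open>e\<close> and
      membership of \<open>x\<close> no longer change, so the first kind of badness would
      occur.\<close>
    have correct1: "v = of_bool (x \<in> D1 \<union> f)"
      if f: "finite f" "f \<subseteq> S1" and e: "finite e" "\<forall>y\<in>e. eval (D1 \<union> f) q y (Suc 0)"
        and ev: "eval (D \<union> e) p x v" for f e x v
    proof -
      obtain m
        where m: "\<forall>X'. (\<forall>z<m. z \<in> X' \<longleftrightarrow> z \<in> D1 \<union> f) \<longrightarrow> (\<forall>y\<in>e. eval X' q y (Suc 0))"
        using e by (rule eval_use_finite)
      obtain R where R: "(D1 \<union> f, R) \<in> ideal_conditions I" "extends (D1 \<union> f, R) (D1, S1)"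
          "\<forall>s\<in>R. max m (Suc x) \<le> s"
        using extension_in_ideal_conditions[OF pair DS f S1(2) order_refl S1(3)] by metis
      have use: "\<forall>y\<in>e. eval (D1 \<union> f \<union> set_decode g) q y (Suc 0)" if "set_decode g \<subseteq> R" for g
        using that R(3) by (intro m[THEN spec, THEN mp]) fastforce
      have x: "x \<in> D1 \<union> f \<union> set_decode g \<longleftrightarrow> x \<in> D1 \<union> f" if "set_decode g \<subseteq> R" for g
        using that R(3) by fastforce
      have e_code: "set_decode (set_encode e) = e" using e(1) by simp
      show ?thesis
      proof (rule ccontr)
        assume "v \<noteq> of_bool (x \<in> D1 \<union> f)"
        with use x ev have "\<not> set_decode g \<subseteq> R \<or> (\<forall>y\<in>e. eval (D1 \<union> f \<union> set_decode g) q y (Suc 0)) \<and>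
            eval (D \<union> e) p x v \<and> v \<noteq> of_bool (x \<in> D1 \<union> f \<union> set_decode g)" for g
          by (cases "set_decode g \<subseteq> R") simp_all
        then have "?P (D1 \<union> f) R"
          unfolding sub
          by (rule_tac disjI1, intro exI[of _ "set_encode e"] exI[of _ x] exI[of _ v] allI)
            (simp only: e_code)
        with no[OF R(1,2)] show False by (rule notE)
      qed
    qed
    have total1: "\<exists>g e v. finite g \<and> g \<subseteq> R \<and> finite e \<and> e \<subseteq> R \<and>
        (\<forall>y\<in>e. eval (D1 \<union> f \<union> g) q y (Suc 0)) \<and> eval (D \<union> e) p x v"
      if f: "finite f" "f \<subseteq> S1" and R: "infinite R" "R \<subseteq> S1" "R \<in> I" for f R x
    proof -
      obtain R' where R': "(D1 \<union> f, R') \<in> ideal_conditions I" "extends (D1 \<union> f, R') (D1, S1)"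
          "R' \<subseteq> R"
        using extension_in_ideal_conditions[OF pair DS f R] by metis
      from no[OF R'(1,2)] obtain g e v where "set_decode g \<subseteq> R'" "set_decode e \<subseteq> R'"
          "\<forall>y\<in>set_decode e. eval (D1 \<union> f \<union> set_decode g) q y (Suc 0)"
          "eval (D \<union> set_decode e) p x v"
        unfolding sub by blast
      with R'(3) show ?thesis
        by (intro exI[of _ "set_decode g"] exI[of _ "set_decode e"] exI[of _ v]) auto
    qed
    obtain x where x: "x \<in> S1" using infinite_imp_nonempty[OF S1(2)] by blast
    then have "x \<notin> D1" using S1(4) by blast
    \<comment> \<open>Approximations built above \<open>x\<close> omit \<open>x\<close>. Only finite
      data and \<open>S1\<close> enter, so \<open>T\<close> is enumerable in \<open>S1\<close>,
      which keeps the set \<open>R\<close> built from it inside the ideal.\<close>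
    define T where "T l \<longleftrightarrow> set_decode l \<subseteq> S1 \<and> (\<exists>f. set_decode f \<subseteq> S1 \<inter> {x<..} \<and>
      (\<forall>y\<in>set_decode l. eval (D1 \<union> set_decode f) q y (Suc 0)))" for l
    have T_iff: "T l \<longleftrightarrow> (\<exists>f. (\<forall>y<l. y \<notin> set_decode l \<or>
          universal (set_decode (set_encode D1) \<union> set_decode f) (prog_code q) y (Suc 0)) \<and>
        (\<forall>y<l. y \<in> set_decode l \<longrightarrow> y \<in> S1) \<and>
        (\<forall>y<f. y \<in> set_decode f \<longrightarrow> y \<in> S1 \<and> x < y))" for l
    proof -
      have all: "(\<forall>y<l. y \<in> set_decode l \<longrightarrow> K y) \<longleftrightarrow> (\<forall>y\<in>set_decode l. K y)" for l K
        using less_if_in_set_decode by blast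
      show ?thesis
        unfolding imp_conv_disj[symmetric] not_not universal_prog_code set_encode_inverse[OF S1(1)]
          imp_conv_disj[symmetric, of "_ \<in> _"] all T_def by blast
    qed
    have "is_Sigma (Suc 0) S1 (\<lambda>l. \<exists>f. (\<forall>y<l. y \<notin> set_decode l \<or>
          universal (set_decode (set_encode D1) \<union> set_decode f) (prog_code q) y (Suc 0)) \<and>
        (\<forall>y<l. y \<in> set_decode l \<longrightarrow> y \<in> S1) \<and>
        (\<forall>y<f. y \<in> set_decode f \<longrightarrow> y \<in> S1 \<and> x < y))"
      by (intro is_Sigma_ex is_Sigma_conj is_Sigma_universal_all computability_intros;
          rule is_Sigma_if_decidable; intro computability_intros decidable_oracle)
    then have "is_Sigma (Suc 0) S1 T" unfolding T_iff[symmetric] .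
    moreover have "T 0" by (auto simp: T_def intro: exI[of _ 0])
    moreover have "\<exists>r>l. T (l + 2 ^ r)" if Tl: "T l" for l
    proof -
      obtain f where l: "set_decode l \<subseteq> S1" and f: "set_decode f \<subseteq> S1 \<inter> {x<..}"
          "\<forall>y\<in>set_decode l. eval (D1 \<union> set_decode f) q y (Suc 0)"
        using Tl unfolding T_def by blast
      obtain m where m: "\<forall>X'. (\<forall>z<m. z \<in> X' \<longleftrightarrow> z \<in> D1 \<union> set_decode f) \<longrightarrow>
          (\<forall>y\<in>set_decode l. eval X' q y (Suc 0))"
        using finite_set_decode f(2) by (rule eval_use_finite)
      \<comment> \<open>Beyond \<open>m\<close>, additions to the approximation preserve acceptance
        of \<open>l\<close>; beyond \<open>l\<close>, a new element is a legitimate prolongation;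
        beyond \<open>x\<close>, the approximation still omits \<open>x\<close>.\<close>
      obtain R where R: "(D1 \<union> {}, R) \<in> ideal_conditions I" "R \<subseteq> S1"
          "\<forall>s\<in>R. max m (Suc (max l x)) \<le> s"
        using extension_in_ideal_conditions[OF pair DS finite.emptyI empty_subsetI S1(2) order_refl S1(3)]
        by metis
      then have "infinite R" "R \<in> I" by (auto simp: ideal_conditions_def mathias_condition_def)
      then obtain g e v where g: "finite g" "g \<subseteq> R" and e: "finite e" "e \<subseteq> R"
          "\<forall>y\<in>e. eval (D1 \<union> set_decode f \<union> g) q y (Suc 0)" "eval (D \<union> e) p x v"
        using total1[of "set_decode f" R x] f(1) R(2) by auto
      \<comment> \<open>The empty set is accepted over every approximation, so an answer on
        \<open>D\<close> alone would have to be right both with \<open>x\<close> and without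
        it.\<close>
      have "e \<noteq> {}"
      proof
        assume "e = {}"
        with e(4) have "eval (D \<union> {}) p x v" by simp
        from correct1[OF _ _ _ _ this, of "{x}"] correct1[OF _ _ _ _ this, of "{}"] x
        have "v = of_bool (x \<in> D1 \<union> {x})" "v = of_bool (x \<in> D1 \<union> {})" by simp_all
        with \<open>x \<notin> D1\<close> show False by simp
      qed
      then obtain r where "r \<in> e" by blast
      with e(2) R(2,3) have r: "l < r" "r \<in> S1" by (auto simp: Suc_le_eq)
      have "\<forall>y\<in>set_decode l. eval (D1 \<union> set_decode f \<union> g) q y (Suc 0)"
        using g(2) R(3) by (intro m[THEN spec, THEN mp]) fastforce
      moreover have "r \<notin> set_decode l" using r(1) less_if_in_set_decode[of r l] by auto
      then have "set_decode (l + 2 ^ r) = insert r (set_decode l)"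
        using set_decode_plus_power_2[of r l] by (simp add: add.commute)
      moreover have "set_decode (set_encode (set_decode f \<union> g)) = set_decode f \<union> g"
        using g(1) by simp
      moreover have "g \<subseteq> S1 \<inter> {x<..}" using g(2) R(2,3) by fastforce
      ultimately have "T (l + 2 ^ r)"
        unfolding T_def using r(2) l f(1) e(3) \<open>r \<in> e\<close>
        by (intro conjI exI[of _ "set_encode (set_decode f \<union> g)"]) (auto simp: Un_assoc)
      with r(1) show ?thesis by blast
    qed
    ultimately obtain R where R: "infinite R" "R \<le>\<^sub>T S1"
        "\<forall>F\<subseteq>R. finite F \<longrightarrow> (\<exists>l. T l \<and> F \<subseteq> set_decode l)"
      by (rule infinite_set_with_finite_subsets)
    have "R \<subseteq> S1"
    proof
      fix y assume "y \<in> R"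
      with R(3)[THEN spec, of "{y}"] show "y \<in> S1" by (auto simp: T_def)
    qed
    moreover have "R \<in> I" using pair S1(3) R(2) by (rule exact_pair_downward_closed)
    \<comment> \<open>Here \<open>x\<close> is put into the approximation, while \<open>e\<close>
      comes from \<open>R\<close>, all of whose finite subsets are also accepted over approximations
      omitting \<open>x\<close>.\<close>
    ultimately obtain g e v where g: "finite g" "g \<subseteq> S1" and e: "finite e" "e \<subseteq> R"
        "\<forall>y\<in>e. eval (D1 \<union> ({x} \<union> g)) q y (Suc 0)" "eval (D \<union> e) p x v"
      using total1[of "{x}" R x] R(1) x by (auto simp: Un_assoc)
    have "v = 1" using correct1[of "{x} \<union> g" e x v] g e x by simp
    obtain l f where f: "e \<subseteq> set_decode l" "set_decode f \<subseteq> S1 \<inter> {x<..}"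
        "\<forall>y\<in>set_decode l. eval (D1 \<union> set_decode f) q y (Suc 0)"
      using R(3)[THEN spec, of e] e(1,2) unfolding T_def by blast
    have "v = of_bool (x \<in> D1 \<union> set_decode f)"
      using f by (intro correct1[OF _ _ e(1) _ e(4)]) auto
    moreover have "x \<notin> set_decode f" using f(2) by auto
    ultimately show False using \<open>v = 1\<close> \<open>x \<notin> D1\<close> by simp
  qed
qed

theorem theorem4p5:
  fixes I :: "nat set set" and A0 A1 G :: "nat set"
  assumes "turing_ideal I"
    and "exact_pair I A0 A1"
    and "generic 3 I A0 A1 G"
  shows "\<not> (\<exists>H. generic 3 (principal_ideal G) G G H \<and> H \<subseteq> G \<and> G \<le>\<^sub>T H)"
proof
  assume "\<exists>H. generic 3 (principal_ideal G) G G H \<and> H \<subseteq> G \<and> G \<le>\<^sub>T H"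
  then obtain H p where H: "generic 3 (principal_ideal G) G G H" "H \<subseteq> G" "computes p H G"
    by (auto simp: turing_le_def)
  \<comment> \<open>For the presentation \<open>G, G\<close>, definability is measured relative to
    \<open>G \<oplus>\<^sub>T G\<close>, from which \<open>G\<close> can be read.\<close>
  have "G \<le>\<^sub>T G \<oplus>\<^sub>T G"
    unfolding turing_le_iff_decidable by (intro decidable_turing_join computable_id)
  from generic_computes[OF exact_pair_principal_ideal H(1,3) this]
  obtain D S where DS: "(D, S) \<in> ideal_conditions (principal_ideal G)" "satisfies H (D, S)"
    and correct: "\<And>E x v. finite E \<Longrightarrow> E \<subseteq> S \<Longrightarrow> eval (D \<union> E) p x v \<Longrightarrow> v = of_bool (x \<in> G)"
    and total: "\<And>R x. R \<subseteq> S \<Longrightarrow> infinite R \<Longrightarrow> R \<in> principal_ideal G \<Longrightarrow>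
      \<exists>E v. finite E \<and> E \<subseteq> R \<and> eval (D \<union> E) p x v"
    by metis
  have D: "finite D" "S \<le>\<^sub>T G"
    using DS(1) by (auto simp: ideal_conditions_def mathias_condition_def principal_ideal_def)
  have "infinite H" using generic_infinite[OF exact_pair_principal_ideal H(1)] .
  moreover have "H \<subseteq> D \<union> (S \<inter> G)" using DS(2) H(2) by (auto simp: satisfies_def)
  ultimately have inf: "infinite (S \<inter> G)" using D(1) by (meson finite_UnI finite_subset)
  \<comment> \<open>These sets serve as reservoirs for \<open>total\<close>; removing a finite
    \<open>F\<close> lets the answering set avoid a prescribed stem.\<close>
  have le: "S \<inter> G - F \<le>\<^sub>T G" if "finite F" for F
  proof -
    have "decidable_in G (\<lambda>x. (x \<in> S \<and> x \<in> G) \<and> x \<notin> set_decode (set_encode F))"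
      by (intro computability_intros decidable_turing_le[OF D(2)] decidable_oracle)
    with that show ?thesis by (simp add: turing_le_iff_decidable)
  qed
  from le[of "{}"] obtain q where "computes q G (S \<inter> G)" by (auto simp: turing_le_def)
  then show False
  proof (rule generic_not_computed_from_subsets[OF assms(2,3)])
    show "\<exists>E v. finite E \<and> E \<subseteq> S \<inter> G - F \<and> eval (D \<union> E) p x v" if "finite F" for F x
      using total[of "S \<inter> G - F"] le[OF that] that inf
      by (auto simp: principal_ideal_def Diff_infinite_finite)
  qed (use D(1) correct in auto)
qed

end
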